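(* Let $\alpha,\beta,b>0$ and $q=\alpha+\beta$. Let $\pi_0$ and $\tilde\pi_0$ be probability densities on $(0,\infty)$ such that (1) $\pi_0(x)\propto x^{q-1}\int_0^\infty \lambda^q e^{-\lambda x}\,dU_0(\lambda)$, $x>0$, for some probability measure $U_0$ with support $[u_0,o_0]\subset(0,\infty)$; (2) the density $h_0:=\tilde\pi_0/\pi_0$ is Lipschitz continuous and $h_0\ge H>0$ for some constant $H$. Let $(X_n)_{n\ge 0}$, $(Y_n)_{n\ge1}$ be the hidden Markov model $X_n=bX_{n-1}W_n$, $Y_n=X_n^{-1}G_n$ with (true) initial distribution $X_0\sim\tilde\pi_0$, and let $\pi_n^{y_{1:n}}$ and $\tilde\pi_n^{y_{1:n}}$ be the optimal filters with respect to the initial conditions $\pi_0$ and $\tilde\pi_0$, respectively. Then for almost every realization $y_1,y_2,\dots$ of the observation sequence $Y_1,Y_2,\dots$ the following holds: for every $\delta$ with $0<\delta<E(W_1^\beta)^{-1/\beta}$, $$\|\pi_n^{y_{1:n}}-\tilde\pi_n^{y_{1:n}}\|_{var}=\mathcal O(\delta^{-n}),\qquad n\to\infty .$$ In particular (since $E(W_1^\beta)^{-1/\beta}>1$) the optimal filter is stable, i.e. $\|\pi_n^{y_{1:n}}-\tilde\pi_n^{y_{1:n}}\|_{var}\to0$, for almost all sequences of observations. The constant in $\mathcal O$ may depend on the sequence $y_1,y_2,\dots$ and on $\delta$.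
   Context: Hidden Markov model: $X_n=bX_{n-1}W_n$, $Y_n=X_n^{-1}G_n$, $n\in\mathbb N=\{1,2,\dots\}$, where the $W_n$ are i.i.d. $\mathrm{Beta}(\alpha,\beta)$-distributed, the $G_n$ are i.i.d. $\Gamma(1,\beta)$-distributed, and $X_0>0$, $(W_n)_n$, $(G_n)_n$ are independent. Here $\Gamma(\lambda,r)$ denotes the Gamma distribution with rate $\lambda$ and shape $r$, with density $\frac{\lambda^r}{\Gamma(r)}x^{r-1}e^{-\lambda x}$ on $(0,\infty)$. The transition density of the signal is $p(x,y)=\frac{(bx)^{1-q}}{\mathrm{B}(\alpha,\beta)}y^{\alpha-1}(bx-y)^{\beta-1}\mathbf 1_{[0,bx]}(y)$ with $\mathrm B$ the Beta function, and the conditional density of $Y_n$ given $X_n=x$ is $g(x,y)=\frac{x^\beta}{\Gamma(\beta)}y^{\beta-1}e^{-xy}$, $y>0$. Optimal filter: given an initial density $\pi_0$ and observations $y_{1:n}=(y_1,\dots,y_n)\in(0,\infty)^n$, $\pi_n^{y_{1:n}}$ (the conditional distribution of $X_n$ given $Y_{1:n}=y_{1:n}$ when $X_0\sim\pi_0$) is the probability density defined by $\pi_0^{y_{1:0}}=\pi_0$ and $$\pi_{n+1}^{y_{1:n+1}}(x)=\frac{g(x,y_{n+1})\int_0^\infty p(s,x)\pi_n^{y_{1:n}}(s)\,ds}{\int_0^\infty g(z,y_{n+1})\int_0^\infty p(s,z)\pi_n^{y_{1:n}}(s)\,ds\,dz},\qquad x>0;$$ $\tilde\pi_n^{y_{1:n}}$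 is defined in the same way starting from $\tilde\pi_0$. The symbol $\propto$ means equality up to a normalizing constant. $\|\mu-\nu\|_{var}=\sup_A|\mu(A)-\nu(A)|$ (so it is bounded by 1). *)

theory Defs
  imports "HOL-Probability.Probability" "HOL-Library.Landau_Symbols"
begin

definition beta_density :: "real \<Rightarrow> real \<Rightarrow> real \<Rightarrow> real" where
  "beta_density \<alpha> \<beta> x =
     indicator {0<..<1} x * (x powr (\<alpha> - 1) * (1 - x) powr (\<beta> - 1) / Beta \<alpha> \<beta>)"

text \<open>The first argument of the Gamma density is the rate, the second one the shape.\<close>

definition gamma_density :: "real \<Rightarrow> real \<Rightarrow> real \<Rightarrow> real" where
  "gamma_density l r x =
     indicator {0<..} x * (l powr r / Gamma r * x powr (r - 1) * exp (- l * x))"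

text \<open>
  Densities on the open half-line are represented by functions on the reals whose values
  outside the half-line are ignored.
\<close>

definition halfline_measure :: "(real \<Rightarrow> real) \<Rightarrow> real measure" where
  "halfline_measure f = density lborel (\<lambda>x. ennreal (indicator {0<..} x * f x))"

definition halfline_prob_density :: "(real \<Rightarrow> real) \<Rightarrow> bool" where
  "halfline_prob_density f \<longleftrightarrow>
     set_borel_measurable borel {0<..} f \<and> (\<forall>x>0. 0 \<le> f x) \<and> prob_space (halfline_measure f)"

definition measure_support :: "'a::topological_space measure \<Rightarrow> 'a set" where
  "measure_support M = {x. \<forall>S. open S \<and> x \<in> S \<longrightarrow> emeasure M S > 0}"

definition tv_dist :: "'a measure \<Rightarrow> 'a measure \<Rightarrow> real" where
  "tv_dist M N = (SUP A\<in>sets M. \<bar>measure M A - measure N A\<bar>)"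

definition signal_density :: "real \<Rightarrow> real \<Rightarrow> real \<Rightarrow> real \<Rightarrow> real \<Rightarrow> real" where
  "signal_density \<alpha> \<beta> b x y =
     (b * x) powr (1 - (\<alpha> + \<beta>)) / Beta \<alpha> \<beta>
       * y powr (\<alpha> - 1) * (b * x - y) powr (\<beta> - 1) * indicator {0..b * x} y"

definition obs_density :: "real \<Rightarrow> real \<Rightarrow> real \<Rightarrow> real" where
  "obs_density \<beta> x y = x powr \<beta> / Gamma \<beta> * y powr (\<beta> - 1) * exp (- x * y)"

text \<open>
  The \<open>n\<close>-th filter density depends on the observations \<open>y 1, \<dots>, y n\<close> only; \<open>y 0\<close> is unused.
\<close>

fun filter_density ::
  "real \<Rightarrow> real \<Rightarrow> real \<Rightarrow> (real \<Rightarrow> real) \<Rightarrow> (nat \<Rightarrow> real) \<Rightarrow> nat \<Rightarrow> real \<Rightarrow> real" where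
  "filter_density \<alpha> \<beta> b \<pi>0 y 0 x = \<pi>0 x"
| "filter_density \<alpha> \<beta> b \<pi>0 y (Suc n) x =
     obs_density \<beta> x (y (Suc n))
       * (LBINT s:{0<..}. signal_density \<alpha> \<beta> b s x * filter_density \<alpha> \<beta> b \<pi>0 y n s)
     / (LBINT z:{0<..}. obs_density \<beta> z (y (Suc n))
       * (LBINT s:{0<..}. signal_density \<alpha> \<beta> b s z * filter_density \<alpha> \<beta> b \<pi>0 y n s))"

text \<open>
  The sources of randomness \<open>X 0\<close>, \<open>W n\<close>, \<open>G n\<close> (\<open>n \<ge> 1\<close>) are jointly independent; the
  datatype merely provides one common index set for them.
\<close>

datatype noise_index = Init | Signal_Noise nat | Obs_Noise nat

locale beta_gamma_hmm = prob_space M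
  for M :: "'a measure" and \<alpha> \<beta> b :: real and initial_density :: "real \<Rightarrow> real"
    and W G X Y :: "nat \<Rightarrow> 'a \<Rightarrow> real" +
  assumes X_0: "distributed M lborel (X 0) (\<lambda>x. ennreal (indicator {0<..} x * initial_density x))"
    and W: "\<And>n. n \<ge> 1 \<Longrightarrow> distributed M lborel (W n) (\<lambda>x. ennreal (beta_density \<alpha> \<beta> x))"
    and G: "\<And>n. n \<ge> 1 \<Longrightarrow> distributed M lborel (G n) (\<lambda>x. ennreal (gamma_density 1 \<beta> x))"
    and indep: "indep_vars (\<lambda>_. borel) (case_noise_index (X 0) W G)
                  ({Init} \<union> Signal_Noise ` {1..} \<union> Obs_Noise ` {1..})"
    and X: "\<And>n \<omega>. n \<ge> 1 \<Longrightarrow> \<omega> \<in> space M \<Longrightarrow> X n \<omega> = b * X (n - 1) \<omega> * W n \<omega>"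
    and Y: "\<And>n \<omega>. n \<ge> 1 \<Longrightarrow> \<omega> \<in> space M \<Longrightarrow> Y n \<omega> = inverse (X n \<omega>) * G n \<omega>"

end

theory Submission
  imports Defs
begin

text \<open>
  Put \<open>a n = u0 + (\<Sum>k=1..n. b ^ k * y k)\<close>. If the initial density is the \<open>\<Gamma>(u0, q)\<close> density times
  a function \<open>F\<close>, then the \<open>n\<close>-th filter is, up to normalization, the \<open>\<Gamma>(a n / b ^ n, q)\<close> density times
  \<open>x \<mapsto> E (F (x / b ^ n + T n))\<close>, where \<open>T n\<close> is a sum of independent \<open>\<Gamma>(a k, \<beta>)\<close> variables, \<open>k < n\<close>.
  The two initial conditions correspond to \<open>F = K\<close>, a decreasing mixture of the exponentials
  \<open>exp (- (l - u0) * z)\<close> with \<open>l\<close> in a bounded interval, and to \<open>F = h * K\<close> with \<open>h\<close> Lipschitz.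
  Since \<open>h\<close> is Lipschitz and \<open>K (z + t)\<close> is almost proportional to \<open>K t\<close> for small \<open>z\<close>, the two
  unnormalized filters are proportional up to a relative error of order \<open>n * x / b ^ n\<close>. Chebyshev's
  association inequality bounds the mean of the filter by that of the Gamma distribution,
  \<open>q * b ^ n / a n\<close>, so that the distance of the filters is \<open>O(n / a n)\<close>.

  Finally \<open>a n \<ge> b ^ n * Y n = G n / (X 0 * (\<Prod>k=1..n. W k))\<close>, and two applications of Borel--Cantelli
  (Markov's inequality for \<open>\<Prod>k=1..n. W k powr \<beta>\<close> and the small ball estimate for \<open>G n\<close>) show that
  this is eventually at least \<open>\<delta> ^ n / X 0\<close> for every \<open>\<delta> < E(W 1 powr \<beta>) powr (- 1 / \<beta>)\<close>.
\<close>

section \<open>Gamma distributions and sums of independent Gamma variables\<close>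

lemma gamma_density_nonneg: "l > 0 \<Longrightarrow> r > 0 \<Longrightarrow> 0 \<le> gamma_density l r x"
  by (auto simp: gamma_density_def indicator_def intro!: mult_nonneg_nonneg divide_nonneg_nonneg)

lemma borel_measurable_gamma_density [measurable]: "gamma_density l r \<in> borel_measurable borel"
  unfolding gamma_density_def by measurable

text \<open>The substitution \<open>x = t / l\<close> reduces the total mass to Euler's integral for
  \<open>Gamma r\<close>.\<close>

lemma nn_integral_gamma_density:
  assumes "l > 0" "r > 0"
  shows "(\<integral>\<^sup>+x. ennreal (gamma_density l r x) \<partial>lborel) = 1"
proof -
  have "(\<integral>\<^sup>+x. ennreal (gamma_density l r x) \<partial>lborel)
      = ennreal (1 / l) * (\<integral>\<^sup>+t. ennreal (gamma_density l r (0 + (1 / l) * t)) \<partial>lborel)"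
    using assms by (subst nn_integral_real_affine[where c = "1 / l" and t = 0]) auto
  also have "(\<integral>\<^sup>+t. ennreal (gamma_density l r (0 + (1 / l) * t)) \<partial>lborel)
      = (\<integral>\<^sup>+t. ennreal (l / Gamma r) *
           ennreal (indicator {0..} t * t powr (r - 1) / exp t) \<partial>lborel)"
  proof (intro nn_integral_cong)
    fix t :: real
    have "l powr r * (t / l) powr (r - 1) = l * t powr (r - 1)" if "t > 0"
      using that assms by (simp add: powr_divide powr_diff field_simps)
    then have "l powr r * (t / l) powr (r - 1) / Gamma r = l * t powr (r - 1) / Gamma r" if "t > 0"
      using that by simp
    then have "gamma_density l r (0 + (1 / l) * t)
        = l / Gamma r * (indicator {0..} t * t powr (r - 1) / exp t)"
      using assms by (auto simp: gamma_density_def indicator_def exp_minus field_simps zero_less_divide_iff)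
    then show "ennreal (gamma_density l r (0 + (1 / l) * t)) = ennreal (l / Gamma r) *
        ennreal (indicator {0..} t * t powr (r - 1) / exp t)"
      using assms by (simp add: ennreal_mult'' [symmetric] indicator_def)
  qed
  also have "\<dots> = ennreal (l / Gamma r) * ennreal (Gamma r)"
    using assms by (simp add: nn_integral_cmult Gamma_conv_nn_integral_real)
  also have "ennreal (1 / l) * \<dots> = ennreal (1 / l * (l / Gamma r * Gamma r))"
    using assms by (simp add: ennreal_mult' [symmetric] less_imp_le)
  also have "\<dots> = 1"
    using assms Gamma_real_pos[OF assms(2)] by (simp del: Gamma_real_pos)
  finally show ?thesis .
qed

text \<open>Size biasing raises the shape by one because \<open>Gamma (r + 1) = r * Gamma r\<close>.
  The mean is then read off from the normalization of the density with shape
  \<open>r + 1\<close>.\<close>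

lemma gamma_density_times_self:
  assumes "l > 0" "r > 0"
  shows "x * gamma_density l r x = r / l * gamma_density l (r + 1) x"
proof (cases "x > 0")
  case True
  have 1: "x powr r = x powr (r - 1) * x" and 2: "l powr (r + 1) = l powr r * l"
    using True assms by (simp_all add: powr_diff powr_add)
  have 3: "Gamma (r + 1) = r * Gamma r"
    using assms by (intro Gamma_plus1) (auto elim!: nonpos_Ints_cases)
  have "x * gamma_density l r x
      = l powr r / Gamma r * (x powr (r - 1) * x) * exp (- l * x)"
    using True by (simp add: gamma_density_def)
  also have "\<dots> = r / l * gamma_density l (r + 1) x"
    using True assms by (simp add: gamma_density_def 1 2 3)
  finally show ?thesis .
qed (simp add: gamma_density_def)

definition gamma_measure :: "real \<Rightarrow> real \<Rightarrow> real measure" where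
  "gamma_measure l r = density lborel (\<lambda>x. ennreal (gamma_density l r x))"

lemma sets_gamma_measure [simp, measurable_cong]: "sets (gamma_measure l r) = sets borel"
  by (simp add: gamma_measure_def)

lemma space_gamma_measure [simp]: "space (gamma_measure l r) = UNIV"
  by (simp add: gamma_measure_def)

lemma prob_space_gamma_measure: "l > 0 \<Longrightarrow> r > 0 \<Longrightarrow> prob_space (gamma_measure l r)"
  by (intro prob_spaceI) (simp add: gamma_measure_def emeasure_density nn_integral_gamma_density)

lemma AE_gamma_measure_pos: "AE x in gamma_measure l r. x > 0"
  unfolding gamma_measure_def
  by (subst AE_density) (auto intro!: AE_I2 simp: gamma_density_def indicator_def)

lemma integral_gamma_measure:
  fixes f :: "real \<Rightarrow> real"
  assumes "l > 0" "r > 0" "f \<in> borel_measurable borel"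
  shows "(LINT x|gamma_measure l r. f x) = (LBINT x. gamma_density l r x * f x)"
  unfolding gamma_measure_def using assms gamma_density_nonneg
  by (subst integral_density) auto

lemma integrable_gamma_measure_iff:
  fixes f :: "real \<Rightarrow> real"
  assumes "l > 0" "r > 0" "f \<in> borel_measurable borel"
  shows "integrable (gamma_measure l r) f \<longleftrightarrow> integrable lborel (\<lambda>x. gamma_density l r x * f x)"
  unfolding gamma_measure_def using assms gamma_density_nonneg
  by (subst integrable_density) auto

lemma has_bochner_integral_gamma_density:
  assumes "l > 0" "r > 0"
  shows "has_bochner_integral lborel (gamma_density l r) 1"
  using assms nn_integral_gamma_density[OF assms] gamma_density_nonneg
  by (intro has_bochner_integral_nn_integral) auto

lemma
  assumes "l > 0" "r > 0"
  shows integrable_gamma_measure_id: "integrable (gamma_measure l r) (\<lambda>x. x)"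
    and mean_gamma_measure: "(LINT x|gamma_measure l r. x) = r / l"
proof -
  have eq: "gamma_density l r x * x = r / l * gamma_density l (r + 1) x" for x
    using gamma_density_times_self[OF assms, of x] by (metis mult.commute)
  have "has_bochner_integral lborel (\<lambda>x. gamma_density l r x * x) (r / l * 1)"
    unfolding eq
    by (intro has_bochner_integral_mult_right has_bochner_integral_gamma_density) (use assms in auto)
  then show "integrable (gamma_measure l r) (\<lambda>x. x)" "(LINT x|gamma_measure l r. x) = r / l"
    using assms
    by (simp_all add: integral_gamma_measure integrable_gamma_measure_iff has_bochner_integral_iff)
qed

text \<open>
  Chebyshev's association inequality, from
  \<open>(T x - m) * (g (T x) - g m) \<le> 0\<close> with \<open>m\<close> the expectation of \<open>T\<close>.
\<close>

lemma (in prob_space) expectation_mult_antimono_le: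
  fixes T :: "'a \<Rightarrow> real" and g :: "real \<Rightarrow> real"
  assumes "integrable M T" "integrable M (\<lambda>x. g (T x))" "integrable M (\<lambda>x. T x * g (T x))"
    and "\<And>x y. x \<le> y \<Longrightarrow> g y \<le> g x"
  shows "expectation (\<lambda>x. T x * g (T x)) \<le> expectation T * expectation (\<lambda>x. g (T x))"
proof -
  let ?m = "expectation T"
  have "(T x - ?m) * (g (T x) - g ?m) \<le> 0" for x
    using assms(4)[of "T x" ?m] assms(4)[of ?m "T x"]
    by (cases "T x \<le> ?m") (auto intro: mult_nonneg_nonpos mult_nonpos_nonneg)
  then have "T x * g (T x) - ?m * g (T x) - (g ?m * T x - g ?m * ?m) \<le> 0" for x
    by (simp add: left_diff_distrib right_diff_distrib mult.commute)
  then have "expectation (\<lambda>x. T x * g (T x) - ?m * g (T x) - (g ?m * T x - g ?m * ?m)) \<le> expectation (\<lambda>x. 0)"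
    using assms(1-3) by (intro integral_mono) auto
  then have "expectation (\<lambda>x. T x * g (T x) - ?m * g (T x) - (g ?m * T x - g ?m * ?m)) \<le> 0"
    by simp
  moreover have "expectation (\<lambda>x. T x * g (T x) - ?m * g (T x) - (g ?m * T x - g ?m * ?m))
      = expectation (\<lambda>x. T x * g (T x)) - ?m * expectation (\<lambda>x. g (T x)) - (g ?m * ?m - g ?m * ?m)"
    using assms(1-3) by (simp add: prob_space)
  ultimately show ?thesis by simp
qed

text \<open>The law of the noise \<open>T n\<close>: a sum of independent Gamma variables with rates
  \<open>a k\<close>, \<open>k < n\<close>, and common shape \<open>\<beta>\<close>, the empty sum
  being the Dirac mass at \<open>0\<close>. Each prediction step of the filter contributes one
  convolution factor.\<close>

fun gamma_sum_measure :: "real \<Rightarrow> (nat \<Rightarrow> real) \<Rightarrow> nat \<Rightarrow> real measure" where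
  "gamma_sum_measure \<beta> a 0 = return borel 0"
| "gamma_sum_measure \<beta> a (Suc n) = convolution (gamma_measure (a n) \<beta>) (gamma_sum_measure \<beta> a n)"

declare gamma_sum_measure.simps(2) [simp del]

lemma sets_gamma_sum_measure [simp, measurable_cong]: "sets (gamma_sum_measure \<beta> a n) = sets borel"
  by (cases n) (auto simp: gamma_sum_measure.simps)

lemma space_gamma_sum_measure [simp]: "space (gamma_sum_measure \<beta> a n) = UNIV"
  using sets_eq_imp_space_eq[OF sets_gamma_sum_measure] by simp

section \<open>Integrals against the law of a sum of independent Gamma variables\<close>

context
  fixes \<beta> :: real and a :: "nat \<Rightarrow> real"
  assumes beta_pos: "\<beta> > 0" and a_pos: "\<And>n. a n > 0"
begin

lemma prob_space_gamma_sum_measure: "prob_space (gamma_sum_measure \<beta> a n)"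
proof (induction n)
  case 0
  show ?case by (auto intro!: prob_space_return)
next
  case (Suc n)
  interpret G: prob_space "gamma_measure (a n) \<beta>"
    by (intro prob_space_gamma_measure beta_pos a_pos)
  interpret N: prob_space "gamma_sum_measure \<beta> a n" by (rule Suc)
  interpret P: pair_prob_space "gamma_measure (a n) \<beta>" "gamma_sum_measure \<beta> a n" ..
  show ?case by (simp add: gamma_sum_measure.simps convolution_def P.prob_space_distr)
qed

lemma integrable_convolution_gamma:
  fixes f :: "real \<Rightarrow> real"
  assumes [measurable]: "f \<in> borel_measurable borel"
    and "integrable (gamma_sum_measure \<beta> a (Suc n)) f"
  shows "integrable (gamma_measure (a n) \<beta> \<Otimes>\<^sub>M gamma_sum_measure \<beta> a n) (\<lambda>(x, y). f (x + y))"
  using assms(2) unfolding gamma_sum_measure.simps convolution_def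
  by (subst (asm) integrable_distr_eq) (auto simp: case_prod_unfold)

text \<open>Fubini for the newest summand. Read from right to left, it absorbs the Gamma variable
  created by a prediction step into the noise.\<close>

lemma integral_gamma_sum_measure_Suc:
  fixes f :: "real \<Rightarrow> real"
  assumes [measurable]: "f \<in> borel_measurable borel"
    and int: "integrable (gamma_sum_measure \<beta> a (Suc n)) f"
  shows "(LINT x|gamma_sum_measure \<beta> a (Suc n). f x)
    = (LINT x|gamma_measure (a n) \<beta>. LINT y|gamma_sum_measure \<beta> a n. f (x + y))"
proof -
  interpret G: prob_space "gamma_measure (a n) \<beta>"
    by (intro prob_space_gamma_measure beta_pos a_pos)
  interpret N: prob_space "gamma_sum_measure \<beta> a n" by (rule prob_space_gamma_sum_measure)
  interpret P: pair_prob_space "gamma_measure (a n) \<beta>" "gamma_sum_measure \<beta> a n" ..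
  have "(LINT x|gamma_sum_measure \<beta> a (Suc n). f x)
      = integral\<^sup>L (gamma_measure (a n) \<beta> \<Otimes>\<^sub>M gamma_sum_measure \<beta> a n) (\<lambda>(x, y). f (x + y))"
    unfolding gamma_sum_measure.simps convolution_def
    by (subst integral_distr) (auto simp: case_prod_unfold)
  also have "\<dots> = (LINT x|gamma_measure (a n) \<beta>. LINT y|gamma_sum_measure \<beta> a n. f (x + y))"
    using P.integral_fst'[OF integrable_convolution_gamma[OF assms]] by simp
  finally show ?thesis .
qed

lemma AE_gamma_sum_measure_nonneg: "AE x in gamma_sum_measure \<beta> a n. 0 \<le> x"
proof (induction n)
  case 0
  show ?case by (subst gamma_sum_measure.simps(1), subst AE_return) auto
next
  case (Suc n)
  interpret G: prob_space "gamma_measure (a n) \<beta>"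
    by (intro prob_space_gamma_measure beta_pos a_pos)
  interpret N: prob_space "gamma_sum_measure \<beta> a n" by (rule prob_space_gamma_sum_measure)
  interpret P: pair_prob_space "gamma_measure (a n) \<beta>" "gamma_sum_measure \<beta> a n" ..
  have "AE p in gamma_measure (a n) \<beta> \<Otimes>\<^sub>M gamma_sum_measure \<beta> a n. 0 \<le> fst p + snd p"
  proof (rule P.AE_pair_measure)
    show "AE x in gamma_measure (a n) \<beta>. AE y in gamma_sum_measure \<beta> a n.
        0 \<le> fst (x, y) + snd (x, y)"
      using AE_gamma_measure_pos
    proof eventually_elim
      case (elim x)
      show ?case using Suc by eventually_elim (use elim in simp)
    qed
  qed measurable
  then show ?case
    unfolding gamma_sum_measure.simps convolution_def
    by (subst AE_distr_iff) (auto simp: case_prod_unfold)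
qed

text \<open>Integrability and mean share one induction: splitting off the newest summand by Fubini
  requires the whole sum to be integrable.\<close>

lemma integrable_gamma_sum_measure_id: "integrable (gamma_sum_measure \<beta> a n) (\<lambda>x. x)"
  and mean_gamma_sum_measure: "(LINT x|gamma_sum_measure \<beta> a n. x) = (\<Sum>k<n. \<beta> / a k)"
proof -
  have "integrable (gamma_sum_measure \<beta> a n) (\<lambda>x. x)
      \<and> (LINT x|gamma_sum_measure \<beta> a n. x) = (\<Sum>k<n. \<beta> / a k)"
  proof (induction n)
    case 0
    have "integrable (return borel (0 :: real)) (\<lambda>x. x)"
      by (rule integrableI_bounded) (simp_all add: nn_integral_return)
    moreover have "(LINT x|return borel (0 :: real). x) = 0"
      by (rule integral_return) auto
    ultimately show ?case by simp
  next
    case (Suc n)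
    interpret G: prob_space "gamma_measure (a n) \<beta>"
      by (intro prob_space_gamma_measure beta_pos a_pos)
    interpret N: prob_space "gamma_sum_measure \<beta> a n" by (rule prob_space_gamma_sum_measure)
    interpret P: pair_prob_space "gamma_measure (a n) \<beta>" "gamma_sum_measure \<beta> a n" ..
    note id = integrable_gamma_measure_id[OF a_pos beta_pos, of n]
    have 1: "integrable (gamma_measure (a n) \<beta> \<Otimes>\<^sub>M gamma_sum_measure \<beta> a n) (\<lambda>p. fst p)"
    proof (rule P.Fubini_integrable)
      show "integrable (gamma_measure (a n) \<beta>)
          (\<lambda>x. LINT y|gamma_sum_measure \<beta> a n. norm (fst (x, y)))"
        using id by (simp add: N.prob_space)
    qed auto
    have 2: "integrable (gamma_measure (a n) \<beta> \<Otimes>\<^sub>M gamma_sum_measure \<beta> a n) (\<lambda>p. snd p)"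
    proof (rule P.Fubini_integrable)
      show "integrable (gamma_measure (a n) \<beta>)
          (\<lambda>x. LINT y|gamma_sum_measure \<beta> a n. norm (snd (x, y)))"
        by simp
    qed (use Suc in auto)
    have int: "integrable (gamma_sum_measure \<beta> a (Suc n)) (\<lambda>x. x)"
      unfolding gamma_sum_measure.simps convolution_def
      using Bochner_Integration.integrable_add[OF 1 2]
      by (subst integrable_distr_eq) (auto simp: case_prod_unfold)
    have "(LINT x|gamma_sum_measure \<beta> a (Suc n). x)
        = (LINT x|gamma_measure (a n) \<beta>. LINT y|gamma_sum_measure \<beta> a n. x + y)"
      by (rule integral_gamma_sum_measure_Suc[OF _ int]) simp
    also have "\<dots> = (LINT x|gamma_measure (a n) \<beta>. x + (\<Sum>k<n. \<beta> / a k))"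
      using Suc N.prob_space by simp
    also have "\<dots> = (\<Sum>k<Suc n. \<beta> / a k)"
      using id mean_gamma_measure[OF a_pos beta_pos, of n] G.prob_space by simp
    finally show ?case using int by simp
  qed
  then show "integrable (gamma_sum_measure \<beta> a n) (\<lambda>x. x)"
    "(LINT x|gamma_sum_measure \<beta> a n. x) = (\<Sum>k<n. \<beta> / a k)" by auto
qed

end

section \<open>The form of the filter\<close>

text \<open>A supremum of reals is meaningful only over a set that is bounded above, so the common
  bound \<open>B\<close> is needed for both claims; the empty set witnesses nonnegativity.\<close>

lemma tv_dist_bounds:
  assumes "\<And>A. A \<in> sets M \<Longrightarrow> \<bar>measure M A - measure N A\<bar> \<le> B"
  shows "0 \<le> tv_dist M N" "tv_dist M N \<le> B"
proof -
  have "bdd_above ((\<lambda>A. \<bar>measure M A - measure N A\<bar>) ` sets M)"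
    using assms by (intro bdd_aboveI[where M = B]) auto
  then have "\<bar>measure M {} - measure N {}\<bar> \<le> tv_dist M N"
    unfolding tv_dist_def by (intro cSUP_upper) auto
  then show "0 \<le> tv_dist M N" by simp
  show "tv_dist M N \<le> B"
    unfolding tv_dist_def using assms by (intro cSUP_least) auto
qed

text \<open>Turns probabilities under a filter into expectations under a Gamma law. This law is the
  same for both initial conditions, so that only the factors \<open>e\<close> have to be
  compared.\<close>

lemma measure_halfline_gamma_density:
  assumes "l > 0" "r > 0" and e[measurable]: "e \<in> borel_measurable borel" and "\<And>x. 0 \<le> e x"
    and int: "integrable (gamma_measure l r) e"
    and f: "\<And>x. x > 0 \<Longrightarrow> f x = gamma_density l r x * e x" and A[measurable]: "A \<in> sets borel"
  shows "measure (halfline_measure f) A = (LINT x|gamma_measure l r. indicator A x * e x)"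
proof -
  have "halfline_measure f = density lborel (\<lambda>x. ennreal (gamma_density l r x * e x))"
    unfolding halfline_measure_def
    by (intro arg_cong[where f = "density lborel"] ext) (auto simp: f indicator_def gamma_density_def)
  then have "emeasure (halfline_measure f) A
      = (\<integral>\<^sup>+x. ennreal (gamma_density l r x) * ennreal (indicator A x * e x) \<partial>lborel)"
    using assms(4) gamma_density_nonneg[OF assms(1,2)]
    by (auto simp: emeasure_density ennreal_mult indicator_def intro!: nn_integral_cong)
  also have "\<dots> = (\<integral>\<^sup>+x. ennreal (indicator A x * e x) \<partial>gamma_measure l r)"
    by (simp add: gamma_measure_def nn_integral_density)
  also have "\<dots> = ennreal (LINT x|gamma_measure l r. indicator A x * e x)"
    using assms(4) integrable_mult_indicator[OF _ int, of A] by (intro nn_integral_eq_integral) auto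
  finally show ?thesis
    using assms(4) by (simp add: measure_def Bochner_Integration.integral_nonneg)
qed

lemma (in finite_measure) integrable_linear_bound:
  fixes f :: "'a \<Rightarrow> real"
  assumes "integrable M T" "f \<in> borel_measurable M" "AE x in M. \<bar>f x\<bar> \<le> A + B * \<bar>T x\<bar>"
  shows "integrable M f"
proof (rule Bochner_Integration.integrable_bound[OF _ assms(2)])
  show "integrable M (\<lambda>x. A + B * \<bar>T x\<bar>)"
    using assms(1) by auto
  show "AE x in M. norm (f x) \<le> norm (A + B * \<bar>T x\<bar>)"
    using assms(3) by eventually_elim auto
qed

text \<open>The \<open>a n\<close> of the outline. The rate of the Gamma factor of the filter is
  divided by \<open>b\<close> in the prediction and raised by \<open>y (Suc n)\<close> in the
  update; multiplying it by \<open>b ^ n\<close> turns this recursion into a plain sum.\<close>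

definition obs_rate :: "real \<Rightarrow> real \<Rightarrow> (nat \<Rightarrow> real) \<Rightarrow> nat \<Rightarrow> real" where
  "obs_rate u b y n = u + (\<Sum>k=1..n. b ^ k * y k)"

lemma obs_rate_0 [simp]: "obs_rate u b y 0 = u"
  by (simp add: obs_rate_def)

lemma obs_rate_Suc: "obs_rate u b y (Suc n) = obs_rate u b y n + b ^ Suc n * y (Suc n)"
  by (simp add: obs_rate_def)

section \<open>Exact form of the filter: Gamma density times a kernel\<close>

context
  fixes \<alpha> \<beta> b u :: real and y :: "nat \<Rightarrow> real"
  assumes alpha: "\<alpha> > 0" and beta: "\<beta> > 0" and b: "b > 0" and u: "u > 0"
    and y: "\<And>n. n \<ge> 1 \<Longrightarrow> y n > 0"
begin

lemma obs_rate_ge: "u \<le> obs_rate u b y n" "n \<ge> 1 \<Longrightarrow> b ^ n * y n \<le> obs_rate u b y n"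
proof -
  have "0 \<le> (\<Sum>k=1..n. b ^ k * y k)"
    using b y by (intro sum_nonneg) (simp add: less_imp_le)
  then show "u \<le> obs_rate u b y n" by (simp add: obs_rate_def)
  have "b ^ n * y n \<le> (\<Sum>k=1..n. b ^ k * y k)" if "n \<ge> 1"
    using b y that by (intro member_le_sum) (auto simp: less_imp_le)
  then show "n \<ge> 1 \<Longrightarrow> b ^ n * y n \<le> obs_rate u b y n"
    using u by (simp add: obs_rate_def)
qed

lemma obs_rate_pos: "0 < obs_rate u b y n"
  using u obs_rate_ge(1) by (rule less_le_trans)

text \<open>This is \<open>E (F (x / b ^ n + T n))\<close>. Dividing by \<open>b ^ n\<close> brings
  the signal back to the scale of time \<open>0\<close>.\<close>

definition filter_kernel :: "nat \<Rightarrow> (real \<Rightarrow> real) \<Rightarrow> real \<Rightarrow> real" where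
  "filter_kernel n F x = (LINT t|gamma_sum_measure \<beta> (obs_rate u b y) n. F (x / b ^ n + t))"

abbreviation filter_gamma :: "nat \<Rightarrow> real measure" where
  "filter_gamma n \<equiv> gamma_measure (obs_rate u b y n / b ^ n) (\<alpha> + \<beta>)"

lemma filter_gamma_params: "0 < obs_rate u b y n / b ^ n" "0 < \<alpha> + \<beta>"
  using alpha beta b obs_rate_pos by auto

lemma prob_space_filter_gamma: "prob_space (filter_gamma n)"
  using filter_gamma_params by (rule prob_space_gamma_measure)

lemma prob_space_noise: "prob_space (gamma_sum_measure \<beta> (obs_rate u b y) n)"
  using beta obs_rate_pos by (rule prob_space_gamma_sum_measure)

lemma integrable_noise:
  fixes f :: "real \<Rightarrow> real"
  assumes "f \<in> borel_measurable borel" "\<And>t. t \<ge> 0 \<Longrightarrow> \<bar>f t\<bar> \<le> A + B * t"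
  shows "integrable (gamma_sum_measure \<beta> (obs_rate u b y) n) f"
proof (rule finite_measure.integrable_linear_bound)
  show "integrable (gamma_sum_measure \<beta> (obs_rate u b y) n) (\<lambda>t. t)"
    using beta obs_rate_pos by (rule integrable_gamma_sum_measure_id)
  show "AE t in gamma_sum_measure \<beta> (obs_rate u b y) n. \<bar>f t\<bar> \<le> A + B * \<bar>t\<bar>"
    using AE_gamma_sum_measure_nonneg[where a = "obs_rate u b y" and n = n, OF beta obs_rate_pos]
  proof eventually_elim
    case (elim t)
    then show ?case using assms(2)[of t] by simp
  qed
qed (use assms prob_space_noise prob_space.finite_measure in auto)

lemma borel_measurable_filter_kernel [measurable]:
  assumes [measurable]: "F \<in> borel_measurable borel"
  shows "filter_kernel n F \<in> borel_measurable borel"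
proof -
  interpret prob_space "gamma_sum_measure \<beta> (obs_rate u b y) n" by (rule prob_space_noise)
  show ?thesis unfolding filter_kernel_def by measurable
qed

section \<open>The filter recursion for positive kernels of linear growth\<close>

context
  fixes F :: "real \<Rightarrow> real" and A B :: real
  assumes F[measurable]: "F \<in> borel_measurable borel" and F_pos: "\<And>z. 0 < F z"
    and F_le: "\<And>z. F z \<le> A + B * \<bar>z\<bar>" and B: "B \<ge> 0"
begin

text \<open>Linear growth of \<open>F\<close> is the class that contains both a bounded
  \<open>K\<close> and the product of \<open>K\<close> with a Lipschitz function; it suffices
  because the noise has a finite mean.\<close>

lemma integrable_noise_shift:
  "integrable (gamma_sum_measure \<beta> (obs_rate u b y) n) (\<lambda>t. F (z + t))"
proof (rule integrable_noise)
  fix t :: real assume "t \<ge> 0"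
  have "\<bar>F (z + t)\<bar> \<le> A + B * \<bar>z + t\<bar>"
    using F_le F_pos[of "z + t"] by simp
  also have "\<dots> \<le> A + B * (\<bar>z\<bar> + t)"
    using B \<open>t \<ge> 0\<close> by (intro add_left_mono mult_left_mono) auto
  finally show "\<bar>F (z + t)\<bar> \<le> (A + B * \<bar>z\<bar>) + B * t" by (simp add: algebra_simps)
qed simp

lemma filter_kernel_pos: "0 < filter_kernel n F x"
proof -
  interpret prob_space "gamma_sum_measure \<beta> (obs_rate u b y) n" by (rule prob_space_noise)
  show ?thesis
    unfolding filter_kernel_def using F_pos
    by (intro integral_less_AE_space[where X = "\<lambda>_. 0", simplified] integrable_noise_shift)
       (auto simp: emeasure_space_1[simplified])
qed

lemma integrable_filter_kernel: "integrable (filter_gamma n) (filter_kernel n F)"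
proof (rule finite_measure.integrable_linear_bound)
  interpret N: prob_space "gamma_sum_measure \<beta> (obs_rate u b y) n" by (rule prob_space_noise)
  let ?m = "LINT t|gamma_sum_measure \<beta> (obs_rate u b y) n. t"
  note id = integrable_gamma_sum_measure_id[where a = "obs_rate u b y" and n = n, OF beta obs_rate_pos]
  show "finite_measure (filter_gamma n)"
    using prob_space_filter_gamma by (rule prob_space.finite_measure)
  show "integrable (filter_gamma n) (\<lambda>x. x)"
    using filter_gamma_params by (rule integrable_gamma_measure_id)
  show "AE x in filter_gamma n. \<bar>filter_kernel n F x\<bar> \<le> (A + B * ?m) + (B / b ^ n) * \<bar>x\<bar>"
  proof (rule AE_I2)
    fix x
    have "filter_kernel n F x
        \<le> (LINT t|gamma_sum_measure \<beta> (obs_rate u b y) n. (A + B * \<bar>x / b ^ n\<bar>) + B * t)"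
      unfolding filter_kernel_def
    proof (rule integral_mono_AE)
      show "AE t in gamma_sum_measure \<beta> (obs_rate u b y) n.
          F (x / b ^ n + t) \<le> (A + B * \<bar>x / b ^ n\<bar>) + B * t"
        using AE_gamma_sum_measure_nonneg[where a = "obs_rate u b y" and n = n, OF beta obs_rate_pos]
      proof eventually_elim
        case (elim t)
        have "F (x / b ^ n + t) \<le> A + B * \<bar>x / b ^ n + t\<bar>" by (rule F_le)
        also have "\<dots> \<le> A + B * (\<bar>x / b ^ n\<bar> + t)"
          using B elim abs_triangle_ineq[of "x / b ^ n" t]
          by (intro add_left_mono mult_left_mono) auto
        finally show ?case by (simp add: algebra_simps)
      qed
    qed (use id integrable_noise_shift in auto)
    also have "\<dots> = (A + B * \<bar>x / b ^ n\<bar>) + B * ?m"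
      using id N.prob_space by simp
    finally show "\<bar>filter_kernel n F x\<bar> \<le> (A + B * ?m) + (B / b ^ n) * \<bar>x\<bar>"
      using filter_kernel_pos[of n x] b by (simp add: abs_divide)
  qed
qed simp

lemma integral_filter_kernel_pos: "0 < (LINT x|filter_gamma n. filter_kernel n F x)"
proof -
  interpret prob_space "filter_gamma n" by (rule prob_space_filter_gamma)
  show ?thesis
    using filter_kernel_pos
    by (intro integral_less_AE_space[where X = "\<lambda>_. 0", simplified] integrable_filter_kernel)
       (auto simp: emeasure_space_1[simplified])
qed

text \<open>
  The substitution \<open>s = x / b + b ^ n * t\<close> turns the prediction integral into the expectation of the
  kernel shifted by a Gamma variable with rate \<open>obs_rate u b y n\<close> and shape \<open>\<beta>\<close>.
\<close>

lemma signal_prediction: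
  assumes f: "\<And>s. s > 0 \<Longrightarrow>
      f s = C * (gamma_density (obs_rate u b y n / b ^ n) (\<alpha> + \<beta>) s * filter_kernel n F s)"
    and "C > 0"
  obtains D where "D > 0" "\<And>x. x > 0 \<Longrightarrow> (LBINT s:{0<..}. signal_density \<alpha> \<beta> b s x * f s)
      = D * (x powr (\<alpha> - 1) * exp (- (obs_rate u b y n / b ^ Suc n * x)) * filter_kernel (Suc n) F x)"
proof
  define c a q where "c = b ^ n" and "a = obs_rate u b y n" and "q = \<alpha> + \<beta>"
  have pos: "c > 0" "a > 0" "q > 0"
    using b alpha beta obs_rate_pos by (auto simp: c_def a_def q_def)
  \<comment> \<open>The leading \<open>c\<close> is the Jacobian. Dividing by
    \<open>a powr \<beta> / Gamma \<beta>\<close> supplies the normalizing constant of the Gamma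
    density in \<open>t\<close>; the rest collects the constants of the transition density and of
    \<open>f\<close>.\<close>
  define D where "D = c * (b powr (1 - q) / Beta \<alpha> \<beta> * (b * c) powr (\<beta> - 1)
      * ((a / c) powr q / Gamma q) * C / (a powr \<beta> / Gamma \<beta>))"
  have Beta_pos: "Beta \<alpha> \<beta> > 0"
    using alpha beta by (simp add: Beta_def)
  show "D > 0"
    unfolding D_def using pos b beta \<open>C > 0\<close> Beta_pos Gamma_real_pos[of q] Gamma_real_pos[of \<beta>]
    by (auto intro!: mult_pos_pos divide_pos_pos simp del: Gamma_real_pos)
  fix x :: real assume x: "x > 0"
  let ?e = "x powr (\<alpha> - 1) * exp (- (a / b ^ Suc n * x))"
  have "(LBINT s:{0<..}. signal_density \<alpha> \<beta> b s x * f s)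
      = (LBINT s. indicator {0<..} s * (signal_density \<alpha> \<beta> b s x * f s))"
    by (simp add: set_lebesgue_integral_def)
  also have "\<dots> = c * (LBINT t. indicator {0<..} (x / b + c * t)
      * (signal_density \<alpha> \<beta> b (x / b + c * t) x * f (x / b + c * t)))"
    using pos by (subst lborel_integral_real_affine[where c = c and t = "x / b"]) auto
  also have "\<dots> = c * (LBINT t. D / c * ?e * (gamma_density a \<beta> t * filter_kernel n F (x / b + c * t)))"
  proof (intro arg_cong[where f = "\<lambda>z. c * z"] Bochner_Integration.integral_cong refl)
    fix t :: real
    show "indicator {0<..} (x / b + c * t)
        * (signal_density \<alpha> \<beta> b (x / b + c * t) x * f (x / b + c * t))
      = D / c * ?e * (gamma_density a \<beta> t * filter_kernel n F (x / b + c * t))"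
    proof (cases "t > 0")
      case True
      define s where "s = x / b + c * t"
      have s: "s > 0" "b * s - x = b * c * t" "x \<le> b * s"
        using True x b pos by (auto simp: s_def field_simps intro: add_pos_pos)
      \<comment> \<open>The power of \<open>s\<close> in the transition density cancels the one in
        the Gamma density: this is why the shape has to be
        \<open>\<alpha> + \<beta>\<close>.\<close>
      have "s powr (1 - q) * s powr (q - 1) = 1"
        using s by (simp flip: powr_add)
      then have 1: "(b * s) powr (1 - q) * s powr (q - 1) = b powr (1 - q)"
        using s b by (simp add: powr_mult)
      have "a / c * s = a / b ^ Suc n * x + a * t"
        using b pos by (simp add: s_def c_def field_simps)
      then have 2: "exp (- (a / c) * s) = exp (- (a / b ^ Suc n * x)) * exp (- a * t)"
        by (simp flip: exp_add)
      have 3: "(b * c * t) powr (\<beta> - 1) = (b * c) powr (\<beta> - 1) * t powr (\<beta> - 1)"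
        using True b pos by (simp add: powr_mult)
      have "signal_density \<alpha> \<beta> b s x * f s
          = (b * s) powr (1 - q) / Beta \<alpha> \<beta> * x powr (\<alpha> - 1) * (b * c * t) powr (\<beta> - 1)
            * (C * ((a / c) powr q / Gamma q * s powr (q - 1) * exp (- (a / c) * s) * filter_kernel n F s))"
        using s x f[of s] by (simp add: signal_density_def gamma_density_def q_def a_def c_def)
      also have "\<dots> = ((b * s) powr (1 - q) * s powr (q - 1)) / Beta \<alpha> \<beta> * x powr (\<alpha> - 1)
            * (b * c * t) powr (\<beta> - 1)
            * (C * ((a / c) powr q / Gamma q * exp (- (a / c) * s) * filter_kernel n F s))"
        by (simp add: mult_ac)
      also have "\<dots> = D / c * ?e * (a powr \<beta> / Gamma \<beta> * t powr (\<beta> - 1) * exp (- a * t)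
            * filter_kernel n F s)"
        unfolding 1 2 3 D_def using pos Gamma_real_pos[OF beta]
        by (simp add: mult_ac del: Gamma_real_pos)
      finally show ?thesis
        using True s unfolding s_def by (simp add: gamma_density_def)
    next
      case False
      then have "c * t \<le> 0"
        using pos by (simp add: mult_nonneg_nonpos)
      then have "b * (x / b + c * t) \<le> x"
        using b by (simp add: distrib_left mult_nonneg_nonpos)
      \<comment> \<open>For \<open>t < 0\<close> the point \<open>x\<close> exceeds
        \<open>b * s\<close> and lies outside the support. For \<open>t = 0\<close> it is the
        endpoint, where the factor \<open>0 powr (\<beta> - 1)\<close> is \<open>0\<close> for every
        \<open>\<beta>\<close>.\<close>
      then have "signal_density \<alpha> \<beta> b (x / b + c * t) x = 0"
        by (auto simp: signal_density_def indicator_def)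
      then show ?thesis using False by (simp add: gamma_density_def)
    qed
  qed
  also have "\<dots> = D * ?e * (LBINT t. gamma_density a \<beta> t * filter_kernel n F (x / b + c * t))"
    using pos by simp
  also have "(LBINT t. gamma_density a \<beta> t * filter_kernel n F (x / b + c * t))
      = (LINT t|gamma_measure a \<beta>. filter_kernel n F (x / b + c * t))"
    using pos beta by (subst integral_gamma_measure) auto
  also have "\<dots> = (LINT t|gamma_measure a \<beta>. LINT r|gamma_sum_measure \<beta> (obs_rate u b y) n.
      F (x / b ^ Suc n + (t + r)))"
    unfolding filter_kernel_def using b by (simp add: c_def add_divide_distrib add.assoc)
  also have "\<dots> = (LINT t|gamma_sum_measure \<beta> (obs_rate u b y) (Suc n). F (x / b ^ Suc n + t))"
    unfolding a_def
    by (rule integral_gamma_sum_measure_Suc[OF beta obs_rate_pos, symmetric, of "\<lambda>t. F (x / b ^ Suc n + t)"])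
       (auto simp: integrable_noise_shift simp del: power_Suc)
  finally show "(LBINT s:{0<..}. signal_density \<alpha> \<beta> b s x * f s)
      = D * (x powr (\<alpha> - 1) * exp (- (obs_rate u b y n / b ^ Suc n * x)) * filter_kernel (Suc n) F x)"
    by (simp add: a_def filter_kernel_def del: power_Suc)
qed

text \<open>Seen as a function of \<open>x\<close>, the likelihood is a multiple of
  \<open>x powr \<beta> * exp (- x * y (Suc n))\<close>. Its power restores the exponent
  \<open>\<alpha> + \<beta> - 1\<close> lost in the prediction, and its exponential adds the
  observation to the rate.\<close>

lemma observation_update:
  assumes f: "\<And>s. s > 0 \<Longrightarrow>
      f s = C * (gamma_density (obs_rate u b y n / b ^ n) (\<alpha> + \<beta>) s * filter_kernel n F s)"
    and "C > 0"
  obtains D where "D > 0" "\<And>x. x > 0 \<Longrightarrow>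
      obs_density \<beta> x (y (Suc n)) * (LBINT s:{0<..}. signal_density \<alpha> \<beta> b s x * f s)
      = D * (gamma_density (obs_rate u b y (Suc n) / b ^ Suc n) (\<alpha> + \<beta>) x * filter_kernel (Suc n) F x)"
proof -
  obtain D where D: "D > 0" "\<And>x. x > 0 \<Longrightarrow> (LBINT s:{0<..}. signal_density \<alpha> \<beta> b s x * f s)
      = D * (x powr (\<alpha> - 1) * exp (- (obs_rate u b y n / b ^ Suc n * x)) * filter_kernel (Suc n) F x)"
    using signal_prediction[OF assms] by blast
  define a where "a = obs_rate u b y (Suc n) / b ^ Suc n"
  define q where "q = \<alpha> + \<beta>"
  define E where "E = D * (y (Suc n) powr (\<beta> - 1) / Gamma \<beta>) / (a powr q / Gamma q)"
  have pos: "a > 0" "q > 0"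
    unfolding a_def q_def by (rule filter_gamma_params)+
  have a: "a = obs_rate u b y n / b ^ Suc n + y (Suc n)"
    using b by (simp add: a_def obs_rate_Suc add_divide_distrib)
  show thesis
  proof (rule that)
    show "E > 0"
      unfolding E_def using pos D(1) y[of "Suc n"] beta Gamma_real_pos[of q] Gamma_real_pos[of \<beta>]
      by (auto intro!: mult_pos_pos divide_pos_pos simp del: Gamma_real_pos)
    fix x :: real assume x: "x > 0"
    have 1: "x powr (\<alpha> - 1) * x powr \<beta> = x powr (q - 1)"
      by (simp add: q_def algebra_simps flip: powr_add)
    have 2: "exp (- (obs_rate u b y n / b ^ Suc n * x)) * exp (- x * y (Suc n)) = exp (- a * x)"
      by (simp add: a algebra_simps flip: exp_add)
    have "obs_density \<beta> x (y (Suc n)) * (LBINT s:{0<..}. signal_density \<alpha> \<beta> b s x * f s)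
        = D * (y (Suc n) powr (\<beta> - 1) / Gamma \<beta>) * (x powr (\<alpha> - 1) * x powr \<beta>)
          * (exp (- (obs_rate u b y n / b ^ Suc n * x)) * exp (- x * y (Suc n)))
          * filter_kernel (Suc n) F x"
      unfolding D(2)[OF x] obs_density_def by (simp add: mult_ac del: power_Suc)
    also have "\<dots> = D * (y (Suc n) powr (\<beta> - 1) / Gamma \<beta>) * x powr (q - 1) * exp (- a * x)
          * filter_kernel (Suc n) F x"
      unfolding 1 2 ..
    also have "\<dots> = E * (gamma_density a q x * filter_kernel (Suc n) F x)"
      using x pos Gamma_real_pos[OF pos(2)]
      by (simp add: E_def gamma_density_def mult_ac del: Gamma_real_pos)
    finally show "obs_density \<beta> x (y (Suc n)) * (LBINT s:{0<..}. signal_density \<alpha> \<beta> b s x * f s)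
        = E * (gamma_density (obs_rate u b y (Suc n) / b ^ Suc n) (\<alpha> + \<beta>) x
          * filter_kernel (Suc n) F x)"
      by (simp only: a_def q_def)
  qed
qed

lemma integral_halfline_gamma_density:
  assumes "\<And>x. x > 0 \<Longrightarrow>
      f x = C * (gamma_density (obs_rate u b y n / b ^ n) (\<alpha> + \<beta>) x * filter_kernel n F x)"
  shows "(LBINT x:{0<..}. f x) = C * (LINT x|filter_gamma n. filter_kernel n F x)"
proof -
  have "(LBINT x:{0<..}. f x)
      = (LBINT x. C * (gamma_density (obs_rate u b y n / b ^ n) (\<alpha> + \<beta>) x * filter_kernel n F x))"
    unfolding set_lebesgue_integral_def
    by (intro Bochner_Integration.integral_cong refl)
       (auto simp: assms indicator_def gamma_density_def)
  also have "\<dots> = C * (LINT x|filter_gamma n. filter_kernel n F x)"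
    using filter_gamma_params by (subst integral_gamma_measure) auto
  finally show ?thesis .
qed

text \<open>The normalized form at time \<open>n\<close> enters the update with \<open>C\<close> the
  inverse of its normalizing integral; the constant \<open>D\<close> coming out cancels in the next
  normalization. At time \<open>0\<close> the filter does not normalize, and \<open>C\<close> is
  determined by the total mass one of \<open>\<pi>\<close>.\<close>

lemma filter_density_eq:
  assumes \<pi>: "\<And>x. x > 0 \<Longrightarrow> \<pi> x = C * (gamma_density u (\<alpha> + \<beta>) x * F x)"
    and prob: "halfline_prob_density \<pi>" and "x > 0"
  shows "filter_density \<alpha> \<beta> b \<pi> y n x
    = gamma_density (obs_rate u b y n / b ^ n) (\<alpha> + \<beta>) x * filter_kernel n F x
      / (LINT x|filter_gamma n. filter_kernel n F x)"
  using \<open>x > 0\<close>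
proof (induction n arbitrary: x)
  case 0
  have K0: "filter_kernel 0 F z = F z" for z
    unfolding filter_kernel_def using integral_return[of 0 borel "\<lambda>t. F (z + t)"] by simp
  have "(\<integral>\<^sup>+x. ennreal (indicator {0<..} x * \<pi> x) \<partial>lborel) = 1"
    using prob_space.emeasure_space_1[of "halfline_measure \<pi>"] prob
    by (auto simp: halfline_prob_density_def halfline_measure_def emeasure_density
        set_borel_measurable_def)
  then have "has_bochner_integral lborel (\<lambda>x. indicator {0<..} x * \<pi> x) 1"
    using prob by (intro has_bochner_integral_nn_integral)
      (auto simp: halfline_prob_density_def set_borel_measurable_def indicator_def)
  then have "(LBINT x:{0<..}. \<pi> x) = 1"
    by (simp add: set_lebesgue_integral_def has_bochner_integral_iff)
  then have "C * (LINT x|filter_gamma 0. filter_kernel 0 F x) = 1"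
    using integral_halfline_gamma_density[of \<pi> C 0] \<pi> by (simp add: K0)
  then show ?case
    using \<pi> 0 by (auto simp: K0 field_simps eq_divide_eq)
next
  case (Suc n)
  let ?Z = "\<lambda>n. LINT x|filter_gamma n. filter_kernel n F x"
  have "filter_density \<alpha> \<beta> b \<pi> y n s = 1 / ?Z n *
      (gamma_density (obs_rate u b y n / b ^ n) (\<alpha> + \<beta>) s * filter_kernel n F s)" if "s > 0" for s
    using Suc.IH[OF that] by simp
  from observation_update[OF this] integral_filter_kernel_pos[of n]
  obtain D where D: "D > 0" "\<And>x. x > 0 \<Longrightarrow> obs_density \<beta> x (y (Suc n))
      * (LBINT s:{0<..}. signal_density \<alpha> \<beta> b s x * filter_density \<alpha> \<beta> b \<pi> y n s)
      = D * (gamma_density (obs_rate u b y (Suc n) / b ^ Suc n) (\<alpha> + \<beta>) x * filter_kernel (Suc n) F x)"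
    by auto
  have "(LBINT x:{0<..}. obs_density \<beta> x (y (Suc n))
        * (LBINT s:{0<..}. signal_density \<alpha> \<beta> b s x * filter_density \<alpha> \<beta> b \<pi> y n s))
      = D * ?Z (Suc n)"
    by (rule integral_halfline_gamma_density[OF D(2)])
  then show ?case
    using D(1) by (simp only: filter_density.simps D(2)[OF Suc.prems]) simp
qed

end

section \<open>Comparison of the filters with kernels \<open>K\<close> and
  \<open>h * K\<close>\<close>

context
  fixes K h :: "real \<Rightarrow> real" and D L H :: real
  assumes K[measurable]: "K \<in> borel_measurable borel" and K_pos: "\<And>z. 0 < K z"
    and K_le: "\<And>z. K z \<le> K 0" and K_antimono: "\<And>x z. x \<le> z \<Longrightarrow> K z \<le> K x"
    and K_exp: "\<And>z t. z \<ge> 0 \<Longrightarrow> exp (- D * z) * K t \<le> K (z + t)"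
    and D: "D \<ge> 0"
    and h: "L-lipschitz_on UNIV h" and h_ge: "\<And>z. H \<le> h z" and H: "H > 0"
begin

text \<open>Bounds the mean of \<open>h (T n)\<close>, by \<open>h t \<le> h 0 + L * t\<close> for
  \<open>t \<ge> 0\<close> and the mean of \<open>T n\<close>.\<close>

definition mean_bound :: "nat \<Rightarrow> real" where
  "mean_bound n = h 0 + L * (\<Sum>k<n. \<beta> / obs_rate u b y k)"

lemma L_nonneg: "L \<ge> 0"
  using h by (rule lipschitz_on_nonneg)

lemma h_measurable [measurable]: "h \<in> borel_measurable borel"
  using lipschitz_on_continuous_on[OF h] by (rule borel_measurable_continuous_onI)

lemma h_dist: "\<bar>h (z + t) - h t\<bar> \<le> L * z" if "z \<ge> 0"
  using lipschitz_onD[OF h, of "z + t" t] that by (simp add: dist_real_def)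

lemma h_le: "h z \<le> h 0 + L * \<bar>z\<bar>"
  using lipschitz_onD[OF h, of z 0] by (simp add: dist_real_def)

lemma h_pos: "0 < h z"
  using H h_ge[of z] by linarith

text \<open>Places \<open>h * K\<close> in the class of kernels of linear growth.\<close>

lemma hK_le: "h z * K z \<le> h 0 * K 0 + L * K 0 * \<bar>z\<bar>"
proof -
  have "h z * K z \<le> (h 0 + L * \<bar>z\<bar>) * K 0"
    using h_le h_pos[of z] K_le K_pos[of z] by (intro mult_mono) (auto simp: less_imp_le intro: order_trans[OF less_imp_le[OF h_pos]])
  then show ?thesis by (simp add: algebra_simps)
qed


abbreviation noise_expectation :: "nat \<Rightarrow> (real \<Rightarrow> real) \<Rightarrow> real" where
  "noise_expectation n f \<equiv> (LINT t|gamma_sum_measure \<beta> (obs_rate u b y) n. f t)"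

lemma integrable_K: "integrable (gamma_sum_measure \<beta> (obs_rate u b y) n) (\<lambda>t. K (z + t))"
  by (rule integrable_noise_shift[of K "K 0" 0]) (use K_pos K_le in auto)

lemma integrable_hK: "integrable (gamma_sum_measure \<beta> (obs_rate u b y) n) (\<lambda>t. h (z + t) * K (z + t))"
  by (rule integrable_noise_shift[of "\<lambda>z. h z * K z" "h 0 * K 0" "L * K 0"])
     (use hK_le h_pos K_pos L_nonneg in \<open>auto simp: less_imp_le\<close>)

lemma integrable_h_K: "integrable (gamma_sum_measure \<beta> (obs_rate u b y) n) (\<lambda>t. h t * K (z + t))"
proof (rule integrable_noise)
  fix t :: real assume "t \<ge> 0"
  then have "h t * K (z + t) \<le> (h 0 + L * t) * K 0"
    using h_le[of t] h_pos[of t] K_le[of "z + t"] K_pos[of "z + t"] by (intro mult_mono) auto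
  then show "\<bar>h t * K (z + t)\<bar> \<le> h 0 * K 0 + (L * K 0) * t"
    using h_pos[of t] K_pos[of "z + t"] by (simp add: abs_mult algebra_simps)
qed measurable

lemma integrable_id_K: "integrable (gamma_sum_measure \<beta> (obs_rate u b y) n) (\<lambda>t. t * K (z + t))"
proof (rule integrable_noise)
  fix t :: real assume "t \<ge> 0"
  then show "\<bar>t * K (z + t)\<bar> \<le> 0 + K 0 * t"
    using K_le[of "z + t"] K_pos[of "z + t"] mult_left_mono[of "K (z + t)" "K 0" t]
    by (simp add: abs_mult mult.commute)
qed measurable

text \<open>Since \<open>K (z + t)\<close> decreases in \<open>t\<close>, weighting the noise with
  it does not raise its mean, by Chebyshev's association inequality. The bound is therefore uniform
  in \<open>z\<close>.\<close>

lemma noise_mean_h_le: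
  "noise_expectation n (\<lambda>t. h t * K (z + t)) \<le> mean_bound n * noise_expectation n (\<lambda>t. K (z + t))"
proof -
  interpret N: prob_space "gamma_sum_measure \<beta> (obs_rate u b y) n" by (rule prob_space_noise)
  note id = integrable_gamma_sum_measure_id[where a = "obs_rate u b y" and n = n, OF beta obs_rate_pos]
  have "noise_expectation n (\<lambda>t. h t * K (z + t))
      \<le> noise_expectation n (\<lambda>t. h 0 * K (z + t) + L * (t * K (z + t)))"
  proof (rule integral_mono_AE)
    show "AE t in gamma_sum_measure \<beta> (obs_rate u b y) n.
        h t * K (z + t) \<le> h 0 * K (z + t) + L * (t * K (z + t))"
      using AE_gamma_sum_measure_nonneg[where a = "obs_rate u b y" and n = n, OF beta obs_rate_pos]
    proof eventually_elim
      case (elim t)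
      have "h t * K (z + t) \<le> (h 0 + L * t) * K (z + t)"
        using h_le[of t] elim K_pos[of "z + t"] by (intro mult_right_mono) auto
      then show ?case by (simp add: algebra_simps)
    qed
  qed (use integrable_h_K integrable_K integrable_id_K in auto)
  also have "\<dots> = h 0 * noise_expectation n (\<lambda>t. K (z + t)) + L * noise_expectation n (\<lambda>t. t * K (z + t))"
    using integrable_K integrable_id_K by simp
  also have "\<dots> \<le> h 0 * noise_expectation n (\<lambda>t. K (z + t))
      + L * (noise_expectation n (\<lambda>t. t) * noise_expectation n (\<lambda>t. K (z + t)))"
    using id integrable_K integrable_id_K L_nonneg
    by (intro add_left_mono mult_left_mono N.expectation_mult_antimono_le[where g = "\<lambda>t. K (z + t)"]
        K_antimono) auto
  also have "noise_expectation n (\<lambda>t. t) = (\<Sum>k<n. \<beta> / obs_rate u b y k)"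
    using beta obs_rate_pos by (rule mean_gamma_sum_measure)
  finally show ?thesis
    by (simp add: mean_bound_def algebra_simps)
qed

lemma filter_kernel_K_pos: "0 < filter_kernel n K x"
  by (rule filter_kernel_pos[of K "K 0" 0]) (use K_pos K_le in auto)

text \<open>The shift by \<open>z = x / b ^ n\<close> acts on \<open>h\<close> and on
  \<open>K\<close>. Removing it from \<open>h\<close> costs \<open>L * z\<close> by the Lipschitz
  condition. What remains is the mean of \<open>h\<close> under the noise weighted with
  \<open>K (z + t)\<close>, which is compared with the mean \<open>c\<close> under the weight
  \<open>K t\<close>, the quotient of the two kernels at \<open>x = 0\<close>.\<close>

lemma filter_kernel_quotient:
  obtains c where "0 \<le> c" "\<And>x. x \<ge> 0 \<Longrightarrow> \<bar>filter_kernel n (\<lambda>z. h z * K z) x - c * filter_kernel n K x\<bar>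
    \<le> (L + 2 * D * mean_bound n) / b ^ n * x * filter_kernel n K x"
proof -
  interpret N: prob_space "gamma_sum_measure \<beta> (obs_rate u b y) n" by (rule prob_space_noise)
  define E1 where "E1 z = noise_expectation n (\<lambda>t. K (z + t))" for z
  define Eh where "Eh z = noise_expectation n (\<lambda>t. h t * K (z + t))" for z
  define c where "c = Eh 0 / E1 0"
  let ?B = "mean_bound n"
  have E1_pos: "0 < E1 z" for z
    using filter_kernel_K_pos[of n "z * b ^ n"] b by (simp add: E1_def filter_kernel_def)
  have Eh_le: "Eh z \<le> ?B * E1 z" for z
    unfolding Eh_def E1_def by (rule noise_mean_h_le)
  have "0 \<le> Eh 0"
    unfolding Eh_def using h_pos K_pos by (intro integral_nonneg_AE AE_I2) (auto simp: less_imp_le)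
  then have c: "0 \<le> c" "c \<le> ?B"
    using E1_pos[of 0] Eh_le[of 0] by (auto simp: c_def pos_divide_le_eq)
  have bound: "\<bar>noise_expectation n (\<lambda>t. h (z + t) * K (z + t)) - c * E1 z\<bar>
      \<le> (L + 2 * D * ?B) * z * E1 z" if z: "z \<ge> 0" for z
  proof -
    have "\<bar>noise_expectation n (\<lambda>t. h (z + t) * K (z + t)) - Eh z\<bar>
        = \<bar>noise_expectation n (\<lambda>t. (h (z + t) - h t) * K (z + t))\<bar>"
      unfolding Eh_def using integrable_hK integrable_h_K by (simp add: left_diff_distrib)
    also have "\<dots> \<le> noise_expectation n (\<lambda>t. \<bar>(h (z + t) - h t) * K (z + t)\<bar>)"
      by (rule integral_abs_bound)
    also have "\<dots> \<le> noise_expectation n (\<lambda>t. L * z * K (z + t))"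
    proof (rule integral_mono)
      show "integrable (gamma_sum_measure \<beta> (obs_rate u b y) n) (\<lambda>t. \<bar>(h (z + t) - h t) * K (z + t)\<bar>)"
        using Bochner_Integration.integrable_diff[OF integrable_hK integrable_h_K, of n z z]
        by (intro integrable_abs) (simp add: left_diff_distrib)
      show "\<bar>(h (z + t) - h t) * K (z + t)\<bar> \<le> L * z * K (z + t)" for t
        using h_dist[OF z, of t] K_pos[of "z + t"] by (auto simp: abs_mult intro!: mult_right_mono)
    qed (use integrable_K in auto)
    also have "\<dots> = L * z * E1 z"
      by (simp add: E1_def)
    finally have 1: "\<bar>noise_expectation n (\<lambda>t. h (z + t) * K (z + t)) - Eh z\<bar> \<le> L * z * E1 z" .
    \<comment> \<open>By the choice of \<open>c\<close>, the integral of
      \<open>(h t - c) * K t\<close> vanishes, so subtracting \<open>exp (- D * z) * K t\<close>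
      does not change the expectation. The second factor of \<open>?g\<close> then lies between
      \<open>0\<close> and \<open>D * z * K (z + t)\<close>: the lower bound is the hypothesis on
      exponential decay, the upper one uses that \<open>K\<close> decreases.\<close>
    let ?g = "\<lambda>t. (h t - c) * (K (z + t) - exp (- D * z) * K (0 + t))"
    have g_eq: "?g t = h t * K (z + t) - c * K (z + t) - exp (- D * z) * (h t * K (0 + t))
        + exp (- D * z) * c * K (0 + t)" for t
      by (simp add: algebra_simps)
    have g_int: "integrable (gamma_sum_measure \<beta> (obs_rate u b y) n) ?g"
      unfolding g_eq
      by (intro Bochner_Integration.integrable_add Bochner_Integration.integrable_diff
        integrable_mult_right integrable_K integrable_h_K)
    have "noise_expectation n ?g
        = Eh z - c * E1 z - exp (- D * z) * Eh 0 + exp (- D * z) * c * E1 0"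
      unfolding g_eq E1_def Eh_def
      by (simp add: integrable_K integrable_h_K integrable_K[of _ 0, simplified] integrable_h_K[of _ 0, simplified])
    also have "\<dots> = Eh z - c * E1 z"
      using E1_pos[of 0] by (simp add: c_def)
    finally have "\<bar>Eh z - c * E1 z\<bar> \<le> noise_expectation n (\<lambda>t. \<bar>?g t\<bar>)"
      using integral_abs_bound[of "gamma_sum_measure \<beta> (obs_rate u b y) n" ?g] by simp
    also have "\<dots> \<le> noise_expectation n (\<lambda>t. D * z * (h t * K (z + t) + c * K (z + t)))"
    proof (rule integral_mono)
      fix t
      have "K (z + t) - exp (- D * z) * K t \<le> K (z + t) - exp (- D * z) * K (z + t)"
        using K_antimono[of t "z + t"] z by simp
      also have "\<dots> = (1 - exp (- D * z)) * K (z + t)"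
        by (simp add: algebra_simps)
      also have "\<dots> \<le> (D * z) * K (z + t)"
        using exp_ge_add_one_self[of "- D * z"] K_pos[of "z + t"] by (intro mult_right_mono) auto
      finally have "\<bar>K (z + t) - exp (- D * z) * K (0 + t)\<bar> \<le> D * z * K (z + t)"
        using K_exp[OF z, of t] by simp
      moreover have "\<bar>h t - c\<bar> \<le> h t + c"
        using h_pos[of t] c by auto
      ultimately have "\<bar>?g t\<bar> \<le> (h t + c) * (D * z * K (z + t))"
        unfolding abs_mult using h_pos[of t] c by (intro mult_mono) auto
      then show "\<bar>?g t\<bar> \<le> D * z * (h t * K (z + t) + c * K (z + t))"
        by (simp add: algebra_simps)
    qed (use g_int integrable_K integrable_h_K in auto)
    also have "\<dots> = D * z * (Eh z + c * E1 z)"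
      by (simp add: Eh_def E1_def integrable_K integrable_h_K)
    also have "\<dots> \<le> D * z * (?B * E1 z + ?B * E1 z)"
      using D z Eh_le c E1_pos[of z] by (intro mult_left_mono add_mono mult_right_mono) auto
    finally have 2: "\<bar>Eh z - c * E1 z\<bar> \<le> D * z * (?B * E1 z + ?B * E1 z)" .
    show ?thesis
      using 1 2 by (simp add: algebra_simps)
  qed
  show thesis
  proof (rule that[OF c(1)])
    fix x :: real assume "x \<ge> 0"
    then show "\<bar>filter_kernel n (\<lambda>z. h z * K z) x - c * filter_kernel n K x\<bar>
        \<le> (L + 2 * D * ?B) / b ^ n * x * filter_kernel n K x"
      using bound[of "x / b ^ n"] b by (simp add: filter_kernel_def E1_def)
  qed
qed

text \<open>The distance is at most the \<open>L^1\<close> distance of the normalized kernels under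
  the common Gamma law. By the quotient estimate this is governed by the Gamma mean of
  \<open>x\<close> weighted with the kernel of \<open>K\<close>.\<close>

lemma filter_density_tv_dist:
  fixes n :: nat
  assumes \<pi>: "\<And>x. x > 0 \<Longrightarrow> \<pi> x = C * (gamma_density u (\<alpha> + \<beta>) x * K x)"
    and \<pi>h: "\<And>x. x > 0 \<Longrightarrow> \<pi>h x = C * (gamma_density u (\<alpha> + \<beta>) x * (h x * K x))"
    and prob: "halfline_prob_density \<pi>" "halfline_prob_density \<pi>h"
  defines "d \<equiv> tv_dist (halfline_measure (filter_density \<alpha> \<beta> b \<pi> y n))
      (halfline_measure (filter_density \<alpha> \<beta> b \<pi>h y n))"
  shows "0 \<le> d"
    and "d \<le> 2 * (\<alpha> + \<beta>) * (L + 2 * D * mean_bound n) / (H * obs_rate u b y n)"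
proof -
  let ?\<mu> = "filter_gamma n"
  let ?e1 = "filter_kernel n K" and ?eh = "filter_kernel n (\<lambda>z. h z * K z)"
  define a q where "a = obs_rate u b y n" and "q = \<alpha> + \<beta>"
  define k where "k = (L + 2 * D * mean_bound n) / b ^ n"
  define Z1 Zh where "Z1 = integral\<^sup>L ?\<mu> ?e1" and "Zh = integral\<^sup>L ?\<mu> ?eh"
  have pos: "a > 0" "q > 0"
    using obs_rate_pos alpha beta by (auto simp: a_def q_def)
  have 0: "K z \<le> K 0 + 0 * \<bar>z\<bar>" for z using K_le[of z] by simp
  have 1: "(\<lambda>z. h z * K z) \<in> borel_measurable borel" by measurable
  have 2: "0 < h z * K z" for z using h_pos K_pos by simp
  have 3: "0 \<le> L * K 0" using L_nonneg K_pos[of 0] by simp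
  have int: "integrable ?\<mu> ?e1" "integrable ?\<mu> ?eh"
    using integrable_filter_kernel[OF K K_pos 0 order_refl] integrable_filter_kernel[OF 1 2 hK_le 3] by auto
  have e_pos: "0 < ?e1 x" "0 < ?eh x" for x
    using filter_kernel_K_pos filter_kernel_pos[OF 1 2 hK_le 3] by auto
  have Z_pos: "0 < Z1" "0 < Zh"
    unfolding Z1_def Zh_def
    using integral_filter_kernel_pos[OF K K_pos 0 order_refl] integral_filter_kernel_pos[OF 1 2 hK_le 3] by auto
  obtain c where c: "0 \<le> c" "\<And>x. x \<ge> 0 \<Longrightarrow> \<bar>?eh x - c * ?e1 x\<bar> \<le> k * x * ?e1 x"
    unfolding k_def using filter_kernel_quotient[of n] by blast
  have ae: "AE x in ?\<mu>. 0 < x" by (rule AE_gamma_measure_pos)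
  have id: "integrable ?\<mu> (\<lambda>x. x)" "integral\<^sup>L ?\<mu> (\<lambda>x. x) = q / (a / b ^ n)"
    using integrable_gamma_measure_id mean_gamma_measure filter_gamma_params by (auto simp: a_def q_def)
  have e1_antimono: "?e1 x' \<le> ?e1 x" if "x \<le> x'" for x x'
    unfolding filter_kernel_def using that b
    by (intro integral_mono integrable_K K_antimono) (auto simp: divide_right_mono)
  have e1_le: "?e1 x \<le> K 0" for x
  proof -
    interpret prob_space "gamma_sum_measure \<beta> (obs_rate u b y) n" by (rule prob_space_noise)
    have "?e1 x \<le> noise_expectation n (\<lambda>_. K 0)"
      unfolding filter_kernel_def by (intro integral_mono integrable_K K_le) auto
    then show ?thesis using prob_space by simp
  qed
  have id_e1: "integrable ?\<mu> (\<lambda>x. x * ?e1 x)"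
  proof (rule finite_measure.integrable_linear_bound[OF _ id(1)])
    show "AE x in ?\<mu>. \<bar>x * ?e1 x\<bar> \<le> 0 + K 0 * \<bar>x\<bar>"
      using e1_le e_pos(1) by (auto simp: abs_mult mult.commute less_imp_le intro!: mult_mono AE_I2)
  qed (use prob_space_filter_gamma prob_space.finite_measure in auto)
  \<comment> \<open>The kernel of \<open>K\<close> is decreasing in \<open>x\<close>, so the
    association inequality applies a second time, now to the Gamma law of the filter.\<close>
  have mean_e1: "(LINT x|?\<mu>. x * ?e1 x) \<le> q / (a / b ^ n) * Z1"
    using prob_space.expectation_mult_antimono_le[OF prob_space_filter_gamma id(1) int(1) id_e1 e1_antimono]
    by (simp add: Z1_def id(2))
  have "0 \<le> mean_bound n"
    unfolding mean_bound_def using L_nonneg h_pos[of 0] beta obs_rate_pos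
    by (intro add_nonneg_nonneg mult_nonneg_nonneg sum_nonneg) (auto simp: less_imp_le)
  then have k: "0 \<le> k"
    using L_nonneg D b by (simp add: k_def)
  define I where "I = (LINT x|?\<mu>. \<bar>?eh x - c * ?e1 x\<bar>)"
  have I_int: "integrable ?\<mu> (\<lambda>x. \<bar>?eh x - c * ?e1 x\<bar>)"
    using int by auto
  have "I \<le> (LINT x|?\<mu>. k * (x * ?e1 x))"
    unfolding I_def
  proof (rule integral_mono_AE[OF I_int])
    show "AE x in ?\<mu>. \<bar>?eh x - c * ?e1 x\<bar> \<le> k * (x * ?e1 x)"
      using ae
    proof eventually_elim
      case (elim x)
      then show ?case using c(2)[of x] by (simp add: mult.assoc)
    qed
  qed (use id_e1 in auto)
  also have "\<dots> \<le> k * (q / (a / b ^ n) * Z1)"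
    using mult_left_mono[OF mean_e1 k] by simp
  finally have I_le: "I \<le> k * (q / (a / b ^ n) * Z1)" .
  have "Zh - c * Z1 = (LINT x|?\<mu>. ?eh x - c * ?e1 x)"
    using int by (simp add: Zh_def Z1_def)
  then have "\<bar>Zh - c * Z1\<bar> \<le> I"
    unfolding I_def using integral_abs_bound[of ?\<mu> "\<lambda>x. ?eh x - c * ?e1 x"] by simp
  then have Z_diff: "\<bar>c * Z1 - Zh\<bar> \<le> I"
    by (subst abs_minus_commute)
  \<comment> \<open>The lower bound on \<open>h\<close> makes \<open>Zh\<close> at least a fixed
    multiple of \<open>Z1\<close>, so that \<open>Z1\<close> drops out of the final
    quotient.\<close>
  have "H * ?e1 x \<le> ?eh x" for x
  proof -
    have "H * ?e1 x = noise_expectation n (\<lambda>t. H * K (x / b ^ n + t))"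
      by (simp add: filter_kernel_def)
    also have "\<dots> \<le> ?eh x"
      unfolding filter_kernel_def using h_ge K_pos
      by (intro integral_mono integrable_hK integrable_mult_right integrable_K mult_right_mono)
        (auto simp: less_imp_le)
    finally show ?thesis .
  qed
  then have "(LINT x|?\<mu>. H * ?e1 x) \<le> Zh"
    unfolding Zh_def using int by (intro integral_mono) auto
  then have HZ: "H * Z1 \<le> Zh" by (simp add: Z1_def)
  \<comment> \<open>The deviation of \<open>?eh\<close> from \<open>c * ?e1\<close> enters twice, in
    the numerator and through the normalizing constant; hence the factor \<open>2\<close>.\<close>
  have l1: "(LINT x|?\<mu>. \<bar>?e1 x / Z1 - ?eh x / Zh\<bar>) \<le> 2 * I / Zh"
  proof -
    have "\<bar>?e1 x / Z1 - ?eh x / Zh\<bar> \<le> \<bar>?eh x - c * ?e1 x\<bar> / Zh + ?e1 x * (\<bar>c * Z1 - Zh\<bar> / (Z1 * Zh))" for x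
    proof -
      have "?e1 x / Z1 - ?eh x / Zh = - (?eh x - c * ?e1 x) / Zh - ?e1 x * ((c * Z1 - Zh) / (Z1 * Zh))"
        using Z_pos by (simp add: field_simps)
      also have "\<bar>\<dots>\<bar> \<le> \<bar>- (?eh x - c * ?e1 x) / Zh\<bar> + \<bar>?e1 x * ((c * Z1 - Zh) / (Z1 * Zh))\<bar>"
        by (rule abs_triangle_ineq4)
      finally show ?thesis
        using Z_pos e_pos(1)[of x] by (simp add: abs_mult abs_minus_commute)
    qed
    then have "(LINT x|?\<mu>. \<bar>?e1 x / Z1 - ?eh x / Zh\<bar>)
        \<le> (LINT x|?\<mu>. \<bar>?eh x - c * ?e1 x\<bar> / Zh + ?e1 x * (\<bar>c * Z1 - Zh\<bar> / (Z1 * Zh)))"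
      using int I_int by (intro integral_mono) auto
    also have "\<dots> = I / Zh + Z1 * (\<bar>c * Z1 - Zh\<bar> / (Z1 * Zh))"
      using int I_int by (simp add: I_def Z1_def)
    also have "\<dots> = (I + \<bar>c * Z1 - Zh\<bar>) / Zh"
      using Z_pos by (simp add: add_divide_distrib)
    also have "\<dots> \<le> 2 * I / Zh"
      using Z_diff Z_pos by (intro divide_right_mono) auto
    finally show ?thesis .
  qed
  have "2 * I / Zh \<le> 2 * (k * (q / (a / b ^ n) * Z1)) / (H * Z1)"
  proof (rule frac_le)
    show "0 \<le> 2 * (k * (q / (a / b ^ n) * Z1))"
      using k pos b Z_pos by (intro mult_nonneg_nonneg) auto
  qed (use I_le HZ H Z_pos in auto)
  \<comment> \<open>The \<open>b ^ n\<close> in the mean of the Gamma law cancels the one in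
    \<open>k\<close>, which leaves the decay to \<open>a\<close> alone.\<close>
  also have "\<dots> = 2 * q * (L + 2 * D * mean_bound n) / (H * a)"
    using Z_pos pos b H by (simp add: k_def field_simps)
  finally have bound: "2 * I / Zh \<le> 2 * q * (L + 2 * D * mean_bound n) / (H * a)" .
  have dist: "\<bar>measure (halfline_measure (filter_density \<alpha> \<beta> b \<pi> y n)) S
      - measure (halfline_measure (filter_density \<alpha> \<beta> b \<pi>h y n)) S\<bar> \<le> 2 * I / Zh"
    if S[measurable]: "S \<in> sets borel" for S
  proof -
    have m1: "measure (halfline_measure (filter_density \<alpha> \<beta> b \<pi> y n)) S
        = (LINT x|?\<mu>. indicator S x * (?e1 x / Z1))"
    proof (rule measure_halfline_gamma_density[OF filter_gamma_params])
      show "filter_density \<alpha> \<beta> b \<pi> y n x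
          = gamma_density (obs_rate u b y n / b ^ n) (\<alpha> + \<beta>) x * (?e1 x / Z1)" if "x > 0" for x
        using filter_density_eq[OF K K_pos 0 order_refl \<pi> prob(1) that, of n] by (simp add: Z1_def)
    qed (use int e_pos Z_pos in \<open>auto simp: less_imp_le\<close>)
    have m2: "measure (halfline_measure (filter_density \<alpha> \<beta> b \<pi>h y n)) S
        = (LINT x|?\<mu>. indicator S x * (?eh x / Zh))"
    proof (rule measure_halfline_gamma_density[OF filter_gamma_params])
      show "filter_density \<alpha> \<beta> b \<pi>h y n x
          = gamma_density (obs_rate u b y n / b ^ n) (\<alpha> + \<beta>) x * (?eh x / Zh)" if "x > 0" for x
        using filter_density_eq[OF 1 2 hK_le 3 \<pi>h prob(2) that, of n] by (simp add: Zh_def)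
    qed (use int e_pos Z_pos in \<open>auto simp: less_imp_le\<close>)
    have i: "integrable ?\<mu> (\<lambda>x. indicator S x * (?e1 x / Z1))" "integrable ?\<mu> (\<lambda>x. indicator S x * (?eh x / Zh))"
      using integrable_mult_indicator[of S ?\<mu> "\<lambda>x. ?e1 x / Z1"]
        integrable_mult_indicator[of S ?\<mu> "\<lambda>x. ?eh x / Zh"] int by auto
    have "\<bar>measure (halfline_measure (filter_density \<alpha> \<beta> b \<pi> y n)) S
      - measure (halfline_measure (filter_density \<alpha> \<beta> b \<pi>h y n)) S\<bar>
      = \<bar>LINT x|?\<mu>. indicator S x * (?e1 x / Z1) - indicator S x * (?eh x / Zh)\<bar>"
      unfolding m1 m2 using i by simp
    also have "\<dots> \<le> (LINT x|?\<mu>. \<bar>indicator S x * (?e1 x / Z1) - indicator S x * (?eh x / Zh)\<bar>)"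
      by (rule integral_abs_bound)
    also have "\<dots> \<le> (LINT x|?\<mu>. \<bar>?e1 x / Z1 - ?eh x / Zh\<bar>)"
      using i int by (intro integral_mono) (auto simp: indicator_def)
    also note l1
    finally show ?thesis .
  qed
  show "0 \<le> d" "d \<le> 2 * (\<alpha> + \<beta>) * (L + 2 * D * mean_bound n) / (H * obs_rate u b y n)"
    unfolding d_def a_def[symmetric] q_def[symmetric]
    by (rule tv_dist_bounds, rule order_trans[OF dist bound], simp add: halfline_measure_def)+
qed

text \<open>Estimating every rate from below by \<open>u\<close> is crude, but growth linear in
  \<open>n\<close> is harmless against a geometric rate.\<close>

lemma mean_bound_le: "mean_bound n \<le> h 0 + L * (real n * (\<beta> / u))"
proof -
  have "(\<Sum>k<n. \<beta> / obs_rate u b y k) \<le> (\<Sum>k<n. \<beta> / u)"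
    using obs_rate_ge(1) u beta by (intro sum_mono divide_left_mono mult_pos_pos obs_rate_pos) auto
  from mult_left_mono[OF this L_nonneg] show ?thesis
    by (simp add: mean_bound_def)
qed

lemma filter_density_tv_dist_le:
  assumes "\<And>x. x > 0 \<Longrightarrow> \<pi> x = C * (gamma_density u (\<alpha> + \<beta>) x * K x)"
    and "\<And>x. x > 0 \<Longrightarrow> \<pi>h x = C * (gamma_density u (\<alpha> + \<beta>) x * (h x * K x))"
    and "halfline_prob_density \<pi>" "halfline_prob_density \<pi>h"
  shows "tv_dist (halfline_measure (filter_density \<alpha> \<beta> b \<pi> y n))
      (halfline_measure (filter_density \<alpha> \<beta> b \<pi>h y n))
    \<le> 2 * (\<alpha> + \<beta>) / H * (L + 2 * D * (h 0 + L * (real n * (\<beta> / u)))) / obs_rate u b y n"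
proof -
  note filter_density_tv_dist(2)[OF assms, of n]
  also have "2 * (\<alpha> + \<beta>) * (L + 2 * D * mean_bound n) / (H * obs_rate u b y n)
      = 2 * (\<alpha> + \<beta>) / H * (L + 2 * D * mean_bound n) / obs_rate u b y n"
    using H obs_rate_pos by simp
  also have "\<dots> \<le> 2 * (\<alpha> + \<beta>) / H * (L + 2 * D * (h 0 + L * (real n * (\<beta> / u)))) / obs_rate u b y n"
    using H alpha beta obs_rate_pos D
    by (intro divide_right_mono mult_left_mono add_left_mono mean_bound_le) (auto simp: less_imp_le)
  finally show ?thesis .
qed

end

end

declare h_measurable [measurable del]

section \<open>Growth of the observations\<close>

lemma beta_density_nonneg: "\<alpha> > 0 \<Longrightarrow> \<beta> > 0 \<Longrightarrow> 0 \<le> beta_density \<alpha> \<beta> x"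
  by (auto simp: beta_density_def Beta_def indicator_def intro!: mult_nonneg_nonneg divide_nonneg_nonneg)

lemma borel_measurable_beta_density [measurable]: "beta_density \<alpha> \<beta> \<in> borel_measurable borel"
  unfolding beta_density_def by measurable

text \<open>On \<open>0 < t \<le> x\<close> half of the shape is given up:
  \<open>t powr (r / 2)\<close> is bounded by \<open>x powr (r / 2)\<close>, and the rest is a
  multiple of the Gamma density with shape \<open>r / 2\<close>. Any positive power of
  \<open>x\<close> suffices for Borel--Cantelli.\<close>

lemma (in prob_space) measure_gamma_le:
  assumes X: "distributed M lborel X (\<lambda>x. ennreal (gamma_density 1 r x))" and r: "r > 0" and x: "x > 0"
  shows "prob {\<omega>\<in>space M. X \<omega> \<le> x} \<le> Gamma (r / 2) / Gamma r * x powr (r / 2)"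
proof -
  let ?C = "Gamma (r / 2) / Gamma r * x powr (r / 2)"
  have C: "0 \<le> ?C" using r by (auto intro!: mult_nonneg_nonneg divide_nonneg_nonneg)
  have "{\<omega>\<in>space M. X \<omega> \<le> x} = X -` {..x} \<inter> space M" by auto
  then have "emeasure M {\<omega>\<in>space M. X \<omega> \<le> x} = (\<integral>\<^sup>+t. ennreal (gamma_density 1 r t) * indicator {..x} t \<partial>lborel)"
    using distributed_emeasure[OF X, of "{..x}"] by simp
  also have "\<dots> \<le> (\<integral>\<^sup>+t. ennreal ?C * ennreal (gamma_density 1 (r / 2) t) \<partial>lborel)"
  proof (intro nn_integral_mono)
    fix t :: real
    have "gamma_density 1 r t \<le> ?C * gamma_density 1 (r / 2) t" if t: "0 < t" "t \<le> x"
    proof -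
      have "t powr (r - 1) = t powr (r / 2) * t powr (r / 2 - 1)"
        by (simp flip: powr_add)
      also have "\<dots> \<le> x powr (r / 2) * t powr (r / 2 - 1)"
        using t r by (intro mult_right_mono powr_mono2) auto
      finally have "t powr (r - 1) * exp (- t) / Gamma r
          \<le> x powr (r / 2) * t powr (r / 2 - 1) * exp (- t) / Gamma r"
        using r by (intro divide_right_mono mult_right_mono) auto
      moreover define g where "g = Gamma (r / 2)"
      moreover have "g \<noteq> 0"
        using r Gamma_real_pos[of "r / 2"] unfolding g_def by (metis half_gt_zero less_irrefl)
      ultimately show ?thesis
        using t unfolding gamma_density_def g_def[symmetric] by (simp add: mult_ac)
    qed
    then have "gamma_density 1 r t * indicator {..x} t \<le> ?C * gamma_density 1 (r / 2) t"
      using mult_nonneg_nonneg[OF C gamma_density_nonneg[of 1 "r / 2" t]] r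
      by (cases "0 < t \<and> t \<le> x") (auto simp: indicator_def gamma_density_def[of 1 r])
    then have "ennreal (gamma_density 1 r t * indicator {..x} t) \<le> ennreal (?C * gamma_density 1 (r / 2) t)"
      by (rule ennreal_leI)
    then show "ennreal (gamma_density 1 r t) * indicator {..x} t
        \<le> ennreal ?C * ennreal (gamma_density 1 (r / 2) t)"
      unfolding ennreal_mult[OF C gamma_density_nonneg[of 1 "r / 2" t, OF zero_less_one half_gt_zero[OF r]]]
      by (cases "t \<le> x") simp_all
  qed
  also have "\<dots> = ennreal ?C"
    using r by (simp add: nn_integral_cmult nn_integral_gamma_density)
  finally show ?thesis
    using C by (simp add: emeasure_eq_measure)
qed

section \<open>Almost sure bounds for the noise and the observations\<close>

context beta_gamma_hmm
begin

definition beta_moment :: real where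
  "beta_moment = expectation (\<lambda>\<omega>. W 1 \<omega> powr \<beta>)"

context
  assumes alpha: "\<alpha> > 0" and beta: "\<beta> > 0" and b: "b > 0"
begin

lemma random_variables [measurable]:
  "random_variable borel (X 0)" "n \<ge> 1 \<Longrightarrow> random_variable borel (W n)" "n \<ge> 1 \<Longrightarrow> random_variable borel (G n)"
  using distributed_measurable[OF X_0] distributed_measurable[OF W] distributed_measurable[OF G] by simp_all

lemma AE_X_0_pos: "AE \<omega> in M. 0 < X 0 \<omega>"
  by (subst distributed_AE2[OF X_0]) (auto simp: indicator_def)

lemma AE_W: "n \<ge> 1 \<Longrightarrow> AE \<omega> in M. 0 < W n \<omega> \<and> W n \<omega> < 1"
  by (subst distributed_AE2[OF W]) (auto simp: beta_density_def indicator_def)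

lemma AE_G_pos: "n \<ge> 1 \<Longrightarrow> AE \<omega> in M. 0 < G n \<omega>"
  by (subst distributed_AE2[OF G]) (auto simp: gamma_density_def indicator_def)

lemma integrable_W_powr: "n \<ge> 1 \<Longrightarrow> integrable M (\<lambda>\<omega>. W n \<omega> powr \<beta>)"
proof (rule integrable_const_bound[where B = 1])
  assume "n \<ge> 1"
  show "AE \<omega> in M. norm (W n \<omega> powr \<beta>) \<le> 1"
    using AE_W[OF \<open>n \<ge> 1\<close>]
  proof eventually_elim
    case (elim \<omega>)
    then show ?case using beta by (simp add: powr_le1)
  qed
qed simp

lemma expectation_W_powr: "n \<ge> 1 \<Longrightarrow> expectation (\<lambda>\<omega>. W n \<omega> powr \<beta>) = beta_moment"
  unfolding beta_moment_def
  using distributed_integral[OF W[of n], of "\<lambda>x. x powr \<beta>"] distributed_integral[OF W[of 1], of "\<lambda>x. x powr \<beta>"]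
    beta_density_nonneg[OF alpha beta] by simp

lemma beta_moment_pos: "0 < beta_moment" and beta_moment_less_1: "beta_moment < 1"
proof -
  have "expectation (\<lambda>_. 0) < expectation (\<lambda>\<omega>. W 1 \<omega> powr \<beta>)"
    using AE_W[of 1] integrable_W_powr[of 1]
    by (intro integral_less_AE_space) (auto simp: emeasure_space_1)
  then show "0 < beta_moment" by (simp add: beta_moment_def)
  have "AE \<omega> in M. W 1 \<omega> powr \<beta> < 1"
    using AE_W[of 1, OF order_refl]
  proof eventually_elim
    case (elim \<omega>)
    then show ?case using beta powr_less_mono2[of \<beta> "W 1 \<omega>" 1] by simp
  qed
  then have "expectation (\<lambda>\<omega>. W 1 \<omega> powr \<beta>) < expectation (\<lambda>_. 1)"
    using integrable_W_powr[of 1] by (intro integral_less_AE_space) (auto simp: emeasure_space_1)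
  then show "beta_moment < 1" by (simp add: beta_moment_def prob_space)
qed

text \<open>Independence is given on the common index set of all noise sources, so the product is
  reindexed along the injective \<open>Signal_Noise\<close>; each factor then has the same
  expectation.\<close>

lemma
  shows integrable_prod_W_powr: "integrable M (\<lambda>\<omega>. \<Prod>k=1..n. W k \<omega> powr \<beta>)"
    and expectation_prod_W_powr: "expectation (\<lambda>\<omega>. \<Prod>k=1..n. W k \<omega> powr \<beta>) = beta_moment ^ n"
proof -
  let ?I = "Signal_Noise ` {1..n}"
  let ?Z = "\<lambda>i \<omega>. case_noise_index (X 0) W G i \<omega> powr \<beta>"
  have inj: "inj_on Signal_Noise A" for A by (auto simp: inj_on_def)
  have ind: "indep_vars (\<lambda>_. borel) ?Z ?I"
    by (rule indep_vars_compose2[OF indep_vars_subset[OF indep]]) auto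
  have int: "integrable M (?Z i)" if "i \<in> ?I" for i
    using that integrable_W_powr by auto
  show "integrable M (\<lambda>\<omega>. \<Prod>k=1..n. W k \<omega> powr \<beta>)"
    using indep_vars_integrable[OF _ ind int] by (simp add: prod.reindex[OF inj])
  have "expectation (\<lambda>\<omega>. \<Prod>i\<in>?I. ?Z i \<omega>) = (\<Prod>i\<in>?I. expectation (?Z i))"
    by (rule indep_vars_lebesgue_integral[OF _ ind int]) auto
  also have "\<dots> = (\<Prod>k=1..n. expectation (\<lambda>\<omega>. W k \<omega> powr \<beta>))"
    by (simp add: prod.reindex[OF inj])
  also have "\<dots> = (\<Prod>k=1..n. beta_moment)"
    by (intro prod.cong refl expectation_W_powr) auto
  finally show "expectation (\<lambda>\<omega>. \<Prod>k=1..n. W k \<omega> powr \<beta>) = beta_moment ^ n"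
    by (simp add: prod.reindex[OF inj])
qed

lemma X_eq: "\<omega> \<in> space M \<Longrightarrow> X n \<omega> = b ^ n * X 0 \<omega> * (\<Prod>k=1..n. W k \<omega>)"
  by (induction n) (simp_all add: X prod.nat_ivl_Suc')

lemma AE_noise_pos:
  "AE \<omega> in M. \<omega> \<in> space M \<and> 0 < X 0 \<omega> \<and> (\<forall>n\<ge>1. 0 < W n \<omega>) \<and> (\<forall>n\<ge>1. 0 < G n \<omega>)"
proof -
  have "AE \<omega> in M. \<forall>n\<in>{1..}. 0 < W n \<omega> \<and> 0 < G n \<omega>"
  proof (subst AE_ball_countable)
    show "\<forall>n\<in>{1..}. AE \<omega> in M. 0 < W n \<omega> \<and> 0 < G n \<omega>"
    proof
      fix n :: nat assume "n \<in> {1..}"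
      then have "AE \<omega> in M. 0 < W n \<omega> \<and> W n \<omega> < 1" "AE \<omega> in M. 0 < G n \<omega>"
        using AE_W AE_G_pos by auto
      then show "AE \<omega> in M. 0 < W n \<omega> \<and> 0 < G n \<omega>" by eventually_elim auto
    qed
  qed simp
  then show ?thesis
    using AE_X_0_pos AE_space by eventually_elim auto
qed

text \<open>By Markov's inequality for the power \<open>\<beta>\<close>, the complementary event at
  time \<open>n\<close> has probability at most
  \<open>(\<rho> powr \<beta> * beta_moment) ^ n\<close>. The bound on \<open>\<rho>\<close> says
  that this geometric series converges, and Borel--Cantelli applies.\<close>

lemma AE_eventually_prod_W:
  assumes "0 < \<rho>" "\<rho> < beta_moment powr (- 1 / \<beta>)"
  shows "AE \<omega> in M. \<forall>\<^sub>F n in sequentially. \<rho> ^ n * (\<Prod>k=1..n. W k \<omega>) < 1"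
proof -
  have "\<rho> powr \<beta> < (beta_moment powr (- 1 / \<beta>)) powr \<beta>"
    using assms beta by (intro powr_less_mono2) auto
  also have "\<dots> = 1 / beta_moment"
    using beta beta_moment_pos by (subst powr_powr) (simp add: powr_neg_one)
  finally have q: "\<rho> powr \<beta> * beta_moment < 1"
    using beta_moment_pos by (simp add: field_simps)
  define S where "S n = {\<omega>\<in>space M. (\<Prod>k=1..n. W k \<omega> powr \<beta>) \<ge> inverse ((\<rho> powr \<beta>) ^ n)}" for n
  have S[measurable]: "S n \<in> sets M" for n
    unfolding S_def by measurable
  have le: "prob (S n) \<le> (\<rho> powr \<beta> * beta_moment) ^ n" for n
  proof -
    have "prob (S n) \<le> expectation (\<lambda>\<omega>. \<Prod>k=1..n. W k \<omega> powr \<beta>) / inverse ((\<rho> powr \<beta>) ^ n)"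
      unfolding S_def using assms
      by (intro integral_Markov_inequality_measure[where A = "space M"] integrable_prod_W_powr)
        (auto intro!: prod_nonneg)
    then show ?thesis
      unfolding expectation_prod_W_powr by (simp add: power_mult_distrib field_simps)
  qed
  have "summable (\<lambda>n. prob (S n))"
    using q le beta_moment_pos
    by (intro summable_comparison_test'[OF summable_geometric[of "\<rho> powr \<beta> * beta_moment"], where N = 0]) auto
  then have "AE \<omega> in M. \<forall>\<^sub>F n in sequentially. \<omega> \<in> space M - S n"
    by (intro borel_cantelli_AE1) (auto simp: emeasure_eq_measure)
  then show ?thesis
    using AE_noise_pos
  proof eventually_elim
    case outer: (elim \<omega>)
    from outer(1) show ?case
    proof eventually_elim
      case (elim n)
      let ?p = "\<Prod>k=1..n. W k \<omega>"
      have p: "0 < ?p" using outer(2) by (intro prod_pos) auto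
      have "(\<Prod>k=1..n. W k \<omega> powr \<beta>) = ?p powr \<beta>"
        by (rule prod_powr_distrib[symmetric])
      then have "?p powr \<beta> < inverse ((\<rho> powr \<beta>) ^ n)"
        using elim by (auto simp: S_def not_le)
      moreover have "(\<rho> powr \<beta>) ^ n = (\<rho> ^ n) powr \<beta>"
        using assms by (simp add: powr_powr mult.commute flip: powr_realpow)
      ultimately have "(\<rho> ^ n * ?p) powr \<beta> < 1 powr \<beta>"
        using assms p by (simp add: powr_mult field_simps)
      then show ?case
        using powr_less_cancel2[of \<beta> "\<rho> ^ n * ?p" 1] beta assms p by simp
    qed
  qed
qed

text \<open>The small ball estimate bounds the probability of \<open>G n \<le> \<theta> ^ n\<close>
  by a constant times a convergent geometric sequence.\<close>

lemma AE_eventually_G: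
  assumes "0 < \<theta>" "\<theta> < 1"
  shows "AE \<omega> in M. \<forall>\<^sub>F n in sequentially. \<theta> ^ n < G n \<omega>"
proof -
  \<comment> \<open>Nothing is assumed about \<open>G 0\<close>, not even measurability; a single
    index does not affect an eventual statement, so its event is made empty.\<close>
  define S where "S n = (if n = 0 then {} else {\<omega>\<in>space M. G n \<omega> \<le> \<theta> ^ n})" for n
  have S[measurable]: "S n \<in> sets M" for n
  proof (cases "n = 0")
    case False
    then have [measurable]: "random_variable borel (G n)"
      by (intro random_variables) simp
    from False show ?thesis by (simp add: S_def)
  qed (simp add: S_def)
  let ?C = "Gamma (\<beta> / 2) / Gamma \<beta>"
  have C: "0 \<le> ?C" using beta by (intro divide_nonneg_nonneg) auto
  have le: "prob (S n) \<le> ?C * (\<theta> powr (\<beta> / 2)) ^ n" for n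
  proof (cases "n = 0")
    case False
    have "(\<theta> ^ n) powr (\<beta> / 2) = (\<theta> powr (\<beta> / 2)) ^ n"
      using assms by (simp add: powr_powr mult.commute flip: powr_realpow)
    then show ?thesis
      using False measure_gamma_le[OF G[of n] beta, of "\<theta> ^ n"] assms by (simp add: S_def)
  qed (use C in \<open>simp add: S_def\<close>)
  have "\<theta> powr (\<beta> / 2) < 1"
    using assms beta powr_less_mono2[of "\<beta> / 2" \<theta> 1] by simp
  then have "summable (\<lambda>n. prob (S n))"
    using le
    by (intro summable_comparison_test'[OF summable_mult[OF summable_geometric[of "\<theta> powr (\<beta> / 2)"], of ?C],
        where N = 0]) auto
  then have "AE \<omega> in M. \<forall>\<^sub>F n in sequentially. \<omega> \<in> space M - S n"
    by (intro borel_cantelli_AE1) (auto simp: emeasure_eq_measure)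
  then show ?thesis
  proof eventually_elim
    case (elim \<omega>)
    then show ?case
      using eventually_gt_at_top[of 0] by eventually_elim (auto simp: S_def not_le)
  qed
qed

lemma AE_Y_pos: "AE \<omega> in M. \<forall>n\<ge>1. 0 < Y n \<omega>"
  using AE_noise_pos
proof eventually_elim
  case (elim \<omega>)
  show ?case
  proof (intro allI impI)
    fix n :: nat assume "1 \<le> n"
    have "0 < X n \<omega>"
      using elim b by (subst X_eq) (auto intro!: mult_pos_pos prod_pos)
    then show "0 < Y n \<omega>"
      using elim \<open>1 \<le> n\<close> by (simp add: Y)
  qed
qed

lemma AE_eventually_Y:
  assumes "0 < \<delta>" "\<delta> < beta_moment powr (- 1 / \<beta>)"
  shows "AE \<omega> in M. \<forall>\<^sub>F n in sequentially. \<delta> ^ n \<le> X 0 \<omega> * (b ^ n * Y n \<omega>)"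
proof -
  \<comment> \<open>The gap between \<open>\<delta>\<close> and the critical rate is shared:
    \<open>\<rho> ^ n\<close> is beaten by the inverse of the product of the \<open>W k\<close>, and
    \<open>(\<delta> / \<rho>) ^ n\<close> by \<open>G n\<close>.\<close>
  obtain \<rho> where \<rho>: "\<delta> < \<rho>" "\<rho> < beta_moment powr (- 1 / \<beta>)"
    using dense assms(2) by blast
  have "AE \<omega> in M. \<forall>\<^sub>F n in sequentially. \<rho> ^ n * (\<Prod>k=1..n. W k \<omega>) < 1"
    using \<rho> assms by (intro AE_eventually_prod_W) auto
  moreover have "AE \<omega> in M. \<forall>\<^sub>F n in sequentially. (\<delta> / \<rho>) ^ n < G n \<omega>"
    using \<rho> assms by (intro AE_eventually_G) auto
  ultimately show ?thesis
    using AE_noise_pos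
  proof eventually_elim
    case outer: (elim \<omega>)
    from outer(1,2) eventually_ge_at_top[of 1] show ?case
    proof eventually_elim
      case (elim n)
      let ?p = "\<Prod>k=1..n. W k \<omega>"
      have p: "0 < ?p" using outer(3) by (intro prod_pos) auto
      have "\<delta> ^ n = (\<delta> / \<rho>) ^ n * \<rho> ^ n"
        using \<rho> assms by (simp add: power_divide)
      also have "\<dots> \<le> G n \<omega> * inverse ?p"
        using elim outer(3) p \<rho> assms by (intro mult_mono) (auto simp: field_simps less_imp_le)
      also have "\<dots> = X 0 \<omega> * (b ^ n * Y n \<omega>)"
      proof -
        have "Y n \<omega> = inverse (b ^ n * X 0 \<omega> * ?p) * G n \<omega>"
          using outer(3) elim(3) Y[of n \<omega>] X_eq[of \<omega> n] by (simp only:)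
        moreover have nz: "b ^ n * X 0 \<omega> \<noteq> 0"
          using outer(3) b by auto
        moreover have "X 0 \<omega> * (b ^ n * (inverse (b ^ n * X 0 \<omega> * ?p) * G n \<omega>))
            = (b ^ n * X 0 \<omega> * inverse (b ^ n * X 0 \<omega>)) * (G n \<omega> * inverse ?p)"
          by (simp only: inverse_mult_distrib mult_ac)
        ultimately show ?thesis
          by (simp only: right_inverse[OF nz] mult_1_left)
      qed
      finally show ?case .
    qed
  qed
qed

end

end

section \<open>Stability of the filter\<close>

text \<open>The complement of the support is a union of open null sets; by Lindelof countably many
  of them have the same union, which is therefore null.\<close>

lemma AE_measure_support:
  fixes M :: "'a::second_countable_topology measure"
  assumes sets: "sets M = sets borel"
  shows "AE x in M. x \<in> measure_support M"
proof -
  let ?\<F> = "{S. open S \<and> emeasure M S = 0}"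
  obtain \<F> where \<F>: "\<F> \<subseteq> ?\<F>" "countable \<F>" "\<Union>\<F> = \<Union>?\<F>"
    using Lindelof[of ?\<F>] by auto
  have "(\<Union>S\<in>\<F>. S) \<in> null_sets M"
    using \<F> sets by (intro null_sets_UN') (auto simp: null_sets_def)
  then have "AE x in M. x \<notin> (\<Union>S\<in>\<F>. S)"
    by (rule AE_not_in)
  then show ?thesis
  proof eventually_elim
    case (elim x)
    then have "x \<notin> \<Union>?\<F>" using \<F>(3) by auto
    then show ?case by (auto simp: measure_support_def zero_less_iff_neq_zero)
  qed
qed

text \<open>The quotient of the initial densities is controlled on the open half-line only, whereas
  the filter comparison evaluates \<open>h\<close> at \<open>0\<close> and on the whole line. The
  function is extended continuously to \<open>0\<close> and then as a constant to the left;
  \<open>max 0\<close> does not increase distances, so \<open>L\<close> is kept.\<close>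

lemma lipschitz_extend_halfline:
  fixes f :: "real \<Rightarrow> real"
  assumes "L-lipschitz_on {0<..} f" and "\<And>x. x > 0 \<Longrightarrow> H \<le> f x"
  obtains h where "L-lipschitz_on UNIV h" "\<And>x. H \<le> h x" "\<And>x. x > 0 \<Longrightarrow> h x = f x"
proof -
  obtain g where g: "L-lipschitz_on {0..} g" "\<And>x. x > 0 \<Longrightarrow> g x = f x"
    using lipschitz_extend_closure[OF assms(1)] by (auto simp: closure_greaterThan)
  have "H \<le> g x" if "x \<ge> 0" for x
    using continuous_ge_on_closure[of "{0<..}" g x H] lipschitz_on_continuous_on[OF g(1)] that assms(2) g(2)
    by (auto simp: closure_greaterThan)
  moreover have "L-lipschitz_on UNIV (\<lambda>x. g (max 0 x))"
  proof (rule lipschitz_onI)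
    fix x y :: real
    have "dist (g (max 0 x)) (g (max 0 y)) \<le> L * dist (max 0 x) (max 0 y)"
      using lipschitz_onD[OF g(1)] by simp
    also have "\<dots> \<le> L * dist x y"
      using lipschitz_on_nonneg[OF g(1)] by (intro mult_left_mono) (auto simp: dist_real_def max_def)
    finally show "dist (g (max 0 x)) (g (max 0 y)) \<le> L * dist x y" .
  qed (rule lipschitz_on_nonneg[OF g(1)])
  ultimately show thesis
    using g(2) by (intro that[of "\<lambda>x. g (max 0 x)"]) auto
qed

text \<open>
  The argument of \<open>K\<close> is truncated below at \<open>0\<close>, so that \<open>K\<close> is bounded on the whole line.
\<close>

lemma laplace_mixture_kernel:
  fixes U :: "real measure"
  assumes "prob_space U" and sets[measurable_cong]: "sets U = sets borel"
    and ae: "AE l in U. u \<le> l \<and> l \<le> v" and u: "0 < u" and q: "0 < q"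
  obtains K :: "real \<Rightarrow> real" where "K \<in> borel_measurable borel" "\<And>z. 0 < K z" "\<And>z. K z \<le> K 0"
    "\<And>x z. x \<le> z \<Longrightarrow> K z \<le> K x" "\<And>z t. 0 \<le> z \<Longrightarrow> exp (- (v - u) * z) * K t \<le> K (z + t)"
    "\<And>x. x > 0 \<Longrightarrow> (LINT l:{0<..}|U. l powr q * exp (- l * x)) = exp (- u * x) * K x"
proof -
  interpret U: prob_space U by fact
  \<comment> \<open>The factor \<open>exp (- u * x)\<close> is split off for the Gamma density with
    rate \<open>u\<close>. The remaining exponent is not positive for \<open>l \<ge> u\<close>,
    which bounds \<open>k\<close> by \<open>v powr q\<close>.\<close>
  define k where "k z l = indicator {0<..} l * (l powr q * exp (- (l - u) * max 0 z))" for z l :: real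
  define K where "K z = (LINT l|U. k z l)" for z
  have [measurable]: "k z \<in> borel_measurable U" for z
    unfolding k_def by measurable
  have k_int: "integrable U (k z)" for z
  proof (rule U.integrable_const_bound[where B = "v powr q"])
    show "AE l in U. norm (k z l) \<le> v powr q"
      using ae
    proof eventually_elim
      case (elim l)
      have "l powr q * exp (- (l - u) * max 0 z) \<le> v powr q * 1"
        using elim u q by (intro mult_mono powr_mono2) (auto intro: mult_nonpos_nonneg)
      then show ?case by (simp add: k_def indicator_def)
    qed
  qed simp
  have k_pos: "AE l in U. 0 < k z l" for z
    using ae by eventually_elim (use u in \<open>auto simp: k_def\<close>)
  have antimono: "K z \<le> K x" if "x \<le> z" for x z
    unfolding K_def
  proof (rule integral_mono_AE[OF k_int k_int])
    show "AE l in U. k z l \<le> k x l"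
      using ae
    proof eventually_elim
      case (elim l)
      then have "(l - u) * max 0 x \<le> (l - u) * max 0 z"
        using that by (intro mult_left_mono) auto
      then have "exp (- (l - u) * max 0 z) \<le> exp (- (l - u) * max 0 x)"
        by (simp only: exp_le_cancel_iff mult_minus_left neg_le_iff_le)
      then have "l powr q * exp (- (l - u) * max 0 z) \<le> l powr q * exp (- (l - u) * max 0 x)"
        by (rule mult_left_mono) simp
      then show ?case by (simp add: k_def indicator_def)
    qed
  qed
  have k_max: "K (max 0 z) = K z" for z
    by (simp add: K_def k_def)
  show thesis
  proof (rule that)
    show "K \<in> borel_measurable borel"
      unfolding K_def[abs_def] k_def by measurable
    show "0 < K z" for z
      unfolding K_def
      using U.integral_less_AE_space[of "\<lambda>_. 0" "k z"] k_int k_pos by (simp add: U.emeasure_space_1)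
    show "K z \<le> K 0" for z
      using antimono[of 0 "max 0 z"] k_max by simp
    show "K z \<le> K x" if "x \<le> z" for x z
      using that by (rule antimono)
    show "exp (- (v - u) * z) * K t \<le> K (z + t)" if z: "0 \<le> z" for z t
    proof -
      have "exp (- (v - u) * z) * K t = (LINT l|U. exp (- (v - u) * z) * k t l)"
        by (simp add: K_def)
      also have "\<dots> \<le> K (z + t)"
        unfolding K_def
      proof (rule integral_mono_AE)
        show "AE l in U. exp (- (v - u) * z) * k t l \<le> k (z + t) l"
          using ae
        proof eventually_elim
          case (elim l)
          \<comment> \<open>For \<open>z \<ge> 0\<close> the truncation satisfies
            \<open>max 0 (z + t) \<le> z + max 0 t\<close>. The factor \<open>l - u\<close> of
            \<open>z\<close> is then replaced by its largest value \<open>v - u\<close>, which no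
            longer depends on the mixing variable.\<close>
          have "(l - u) * max 0 (z + t) \<le> (l - u) * (z + max 0 t)"
            using elim z by (intro mult_left_mono) auto
          also have "\<dots> \<le> (v - u) * z + (l - u) * max 0 t"
            using elim z by (simp add: distrib_left mult_right_mono)
          finally have "exp (- (v - u) * z) * exp (- (l - u) * max 0 t) \<le> exp (- (l - u) * max 0 (z + t))"
            unfolding exp_add[symmetric] exp_le_cancel_iff mult_minus_left by linarith
          then have "l powr q * (exp (- (v - u) * z) * exp (- (l - u) * max 0 t))
              \<le> l powr q * exp (- (l - u) * max 0 (z + t))"
            by (intro mult_left_mono) auto
          then show ?case by (auto simp: k_def indicator_def mult_ac)
        qed
      qed (use k_int in auto)
      finally show ?thesis .
    qed
    show "(LINT l:{0<..}|U. l powr q * exp (- l * x)) = exp (- u * x) * K x" if "x > 0" for x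
    proof -
      have "indicator {0<..} l * (l powr q * exp (- l * x)) = exp (- u * x) * k x l" for l
        using that by (simp add: k_def algebra_simps indicator_def flip: exp_add)
      then show ?thesis
        by (simp add: set_lebesgue_integral_def K_def)
    qed
  qed
qed

text \<open>Since \<open>(P + Q * n) * (\<delta> / \<rho>) ^ n\<close> tends to \<open>0\<close>,
  the loss from \<open>\<rho>\<close> to \<open>\<delta>\<close> absorbs the linear factor;
  \<open>x\<close> itself serves as the constant of the estimate.\<close>

lemma geometric_rate_bigo:
  fixes a d :: "nat \<Rightarrow> real"
  assumes \<delta>: "0 < \<delta>" "\<delta> < \<rho>" and d: "\<And>n. 0 \<le> d n" "\<And>n. d n \<le> (P + Q * real n) / a n"
    and a: "\<And>n. 0 < a n" and ev: "\<forall>\<^sub>F n in sequentially. \<rho> ^ n \<le> x * a n"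
  shows "d \<in> O(\<lambda>n. \<delta> powr (- real n))"
proof -
  have "(\<lambda>n. P * (\<delta> / \<rho>) ^ n + Q * (real n * (\<delta> / \<rho>) ^ n)) \<longlonglongrightarrow> P * 0 + Q * 0"
    using \<delta> by (intro tendsto_intros LIMSEQ_power_zero powser_times_n_limit_0) auto
  then have "\<forall>\<^sub>F n in sequentially. P * (\<delta> / \<rho>) ^ n + Q * (real n * (\<delta> / \<rho>) ^ n) < 1"
    by (rule order_tendstoD) simp
  with ev have "\<forall>\<^sub>F n in sequentially. norm (d n) \<le> x * norm (\<delta> powr (- real n))"
  proof eventually_elim
    case (elim n)
    have pos: "0 < \<delta> ^ n" "0 < \<rho> ^ n" using \<delta> by auto
    have "0 < x * a n" using elim(1) pos by linarith
    then have x: "0 < x" using a[of n] by (simp add: zero_less_mult_iff)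
    have "(P + Q * real n) * \<delta> ^ n / \<rho> ^ n < 1"
      using elim(2) by (simp add: power_divide add_divide_distrib distrib_right mult.assoc)
    then have "(P + Q * real n) * \<delta> ^ n < \<rho> ^ n"
      using pos by (simp add: pos_divide_less_eq)
    also have "\<dots> \<le> x * a n" by (rule elim(1))
    finally have "(P + Q * real n) / a n \<le> x / \<delta> ^ n"
      using pos a[of n] by (simp add: field_simps)
    with d(2)[of n] have "d n \<le> x / \<delta> ^ n" by linarith
    then show ?case
      using d(1)[of n] \<delta> by (simp add: powr_minus powr_realpow divide_inverse)
  qed
  then show ?thesis by (rule bigoI)
qed

section \<open>The almost sure rate of convergence\<close>

theorem theorem5:
  fixes \<alpha> \<beta> b q u0 o0 H :: real
    and \<pi>0 \<pi>t0 h0 :: "real \<Rightarrow> real"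
    and U0 :: "real measure"
    and M :: "'a measure"
    and W G X Y :: "nat \<Rightarrow> 'a \<Rightarrow> real"
  assumes "\<alpha> > 0" and "\<beta> > 0" and "b > 0" and "q = \<alpha> + \<beta>"
    and "halfline_prob_density \<pi>0" and "halfline_prob_density \<pi>t0"
    and "prob_space U0" and "sets U0 = sets borel"
    and "measure_support U0 = {u0..o0}" and "0 < u0" and "u0 \<le> o0"
    and "\<exists>c>0. \<forall>x>0. \<pi>0 x =
           c * (x powr (q - 1) * (LINT l:{0<..}|U0. l powr q * exp (- l * x)))"
    and "\<And>x. x > 0 \<Longrightarrow> h0 x = \<pi>t0 x / \<pi>0 x"
    and "\<exists>L. L-lipschitz_on {0<..} h0"
    and "H > 0" and "\<And>x. x > 0 \<Longrightarrow> h0 x \<ge> H"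
    and "beta_gamma_hmm M \<alpha> \<beta> b \<pi>t0 W G X Y"
  defines "d \<equiv> \<lambda>n \<omega>. tv_dist
             (halfline_measure (filter_density \<alpha> \<beta> b \<pi>0 (\<lambda>k. Y k \<omega>) n))
             (halfline_measure (filter_density \<alpha> \<beta> b \<pi>t0 (\<lambda>k. Y k \<omega>) n))"
    and "r \<equiv> (LINT \<omega>|M. W 1 \<omega> powr \<beta>) powr (- 1 / \<beta>)"
  shows "(AE \<omega> in M. \<forall>\<delta>. 0 < \<delta> \<and> \<delta> < r \<longrightarrow> (\<lambda>n. d n \<omega>) \<in> O(\<lambda>n. \<delta> powr (- real n)))
       \<and> r > 1
       \<and> (AE \<omega> in M. (\<lambda>n. d n \<omega>) \<longlonglongrightarrow> 0)"
proof -
  note \<alpha> = assms(1) and \<beta> = assms(2) and b = assms(3) and q = assms(4)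
  interpret beta_gamma_hmm M \<alpha> \<beta> b \<pi>t0 W G X Y by fact
  have q_pos: "q > 0" using \<alpha> \<beta> q by simp
  have r_eq: "r = beta_moment powr (- 1 / \<beta>)"
    unfolding r_def beta_moment_def ..
  note moment = beta_moment_pos[OF \<alpha> \<beta> b] beta_moment_less_1[OF \<alpha> \<beta> b]
  have r: "1 < r"
    using powr_less_mono2_neg[of "- 1 / \<beta>" beta_moment 1] moment \<beta> by (simp add: r_eq)

  have "AE l in U0. l \<in> measure_support U0"
    using assms(8) by (rule AE_measure_support)
  then have "AE l in U0. u0 \<le> l \<and> l \<le> o0"
    using assms(9) by simp
  from laplace_mixture_kernel[OF assms(7,8) this assms(10) q_pos]
  obtain K where K: "K \<in> borel_measurable borel" "\<And>z. 0 < K z" "\<And>z. K z \<le> K 0"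
    "\<And>x z. x \<le> z \<Longrightarrow> K z \<le> K x" "\<And>z t. 0 \<le> z \<Longrightarrow> exp (- (o0 - u0) * z) * K t \<le> K (z + t)"
    and K_eq: "\<And>x. x > 0 \<Longrightarrow> (LINT l:{0<..}|U0. l powr q * exp (- l * x)) = exp (- u0 * x) * K x"
    by blast
  obtain L where "L-lipschitz_on {0<..} h0"
    using assms(14) by blast
  from lipschitz_extend_halfline[OF this assms(16)]
  obtain h where h: "L-lipschitz_on UNIV h" "\<And>x. H \<le> h x" "\<And>x. x > 0 \<Longrightarrow> h x = h0 x"
    by blast
  obtain c where c: "c > 0" "\<And>x. x > 0 \<Longrightarrow> \<pi>0 x =
      c * (x powr (q - 1) * (LINT l:{0<..}|U0. l powr q * exp (- l * x)))"
    using assms(12) by blast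
  \<comment> \<open>Dividing by the normalizing constant of the Gamma density with rate
    \<open>u0\<close> and shape \<open>q\<close> brings \<open>\<pi>0\<close> into the form required
    of an initial density.\<close>
  define C where "C = c / (u0 powr q / Gamma q)"
  have \<pi>: "\<pi>0 x = C * (gamma_density u0 (\<alpha> + \<beta>) x * K x)" if "x > 0" for x
    using that assms(10) Gamma_real_pos[OF q_pos]
    unfolding c(2)[OF that] K_eq[OF that] q[symmetric] by (simp add: C_def gamma_density_def)
  have \<pi>t: "\<pi>t0 x = C * (gamma_density u0 (\<alpha> + \<beta>) x * (h x * K x))" if x: "x > 0" for x
  proof -
    \<comment> \<open>Strict positivity allows the division in the definition of \<open>h0\<close>
      to be undone.\<close>
    have "0 < \<pi>0 x"
      unfolding c(2)[OF x] K_eq[OF x] using c(1) x K(2) by (intro mult_pos_pos) auto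
    then have "\<pi>t0 x = h0 x * \<pi>0 x"
      using assms(13)[OF x] by simp
    then show ?thesis
      using \<pi>[OF x] h(3)[OF x] by (simp add: mult_ac)
  qed
  \<comment> \<open>The coefficients of the total variation bound written as an affine function of
    \<open>n\<close>.\<close>
  define P Q where "P = 2 * (\<alpha> + \<beta>) / H * (L + 2 * (o0 - u0) * h 0)"
    and "Q = 2 * (\<alpha> + \<beta>) / H * (2 * (o0 - u0) * (L * (\<beta> / u0)))"

  \<comment> \<open>The exceptional null set must not depend on \<open>\<delta>\<close>. The growth
    estimate is therefore invoked only for the countably many rational \<open>\<rho>\<close> below
    \<open>r\<close>, each of which serves all \<open>\<delta> < \<rho>\<close>.\<close>
  have main: "AE \<omega> in M. \<forall>\<rho>\<in>{0<..<r} \<inter> \<rat>. \<forall>\<delta>. 0 < \<delta> \<and> \<delta> < \<rho> \<longrightarrow> (\<lambda>n. d n \<omega>) \<in> O(\<lambda>n. \<delta> powr (- real n))"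
  proof (subst AE_ball_countable)
    show "countable ({0<..<r} \<inter> \<rat>)"
      using countable_rat by (rule countable_Int2)
    show "\<forall>\<rho>\<in>{0<..<r} \<inter> \<rat>. AE \<omega> in M. \<forall>\<delta>. 0 < \<delta> \<and> \<delta> < \<rho> \<longrightarrow> (\<lambda>n. d n \<omega>) \<in> O(\<lambda>n. \<delta> powr (- real n))"
    proof
      fix \<rho> assume \<rho>: "\<rho> \<in> {0<..<r} \<inter> \<rat>"
      have "AE \<omega> in M. \<forall>\<^sub>F n in sequentially. \<rho> ^ n \<le> X 0 \<omega> * (b ^ n * Y n \<omega>)"
        using \<rho> by (intro AE_eventually_Y[OF \<alpha> \<beta> b]) (auto simp: r_eq)
      then show "AE \<omega> in M. \<forall>\<delta>. 0 < \<delta> \<and> \<delta> < \<rho> \<longrightarrow> (\<lambda>n. d n \<omega>) \<in> O(\<lambda>n. \<delta> powr (- real n))"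
        using AE_Y_pos[OF \<alpha> \<beta> b] AE_X_0_pos[OF \<alpha> \<beta> b]
      proof eventually_elim
        case (elim \<omega>)
        define y where "y k = Y k \<omega>" for k
        let ?a = "obs_rate u0 b y"
        have y: "\<And>n. n \<ge> 1 \<Longrightarrow> y n > 0" using elim(2) by (simp add: y_def)
        note hyps = \<alpha> \<beta> b assms(10) y
        have D: "0 \<le> o0 - u0" using assms(11) by simp
        note tv = filter_density_tv_dist(1)[where y = y, OF hyps K D h(1,2) assms(15) \<pi> \<pi>t assms(5,6)]
          filter_density_tv_dist_le[where y = y, OF hyps K D h(1,2) assms(15) \<pi> \<pi>t assms(5,6)]
        have "d n \<omega> \<le> (P + Q * real n) / ?a n" for n
        proof -
          have "A * (l + E * (h + l * (m * k))) = A * (l + E * h) + A * (E * (l * k)) * m"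
            for A l E h m k :: real by (simp add: algebra_simps)
          from tv(2)[of n, unfolded this] show ?thesis
            by (simp only: d_def P_def Q_def y_def[abs_def])
        qed
        moreover have "0 \<le> d n \<omega>" for n
          using tv(1)[of n] by (simp add: d_def y_def[abs_def])
        moreover have "\<forall>\<^sub>F n in sequentially. \<rho> ^ n \<le> X 0 \<omega> * ?a n"
          using elim(1) eventually_ge_at_top[of 1]
        proof eventually_elim
          case (elim n)
          have "X 0 \<omega> * (b ^ n * y n) \<le> X 0 \<omega> * ?a n"
            using obs_rate_ge(2)[where y = y, OF hyps elim(2)] \<open>0 < X 0 \<omega>\<close> by (intro mult_left_mono) auto
          then show ?case using elim(1) by (simp add: y_def)
        qed
        ultimately show ?case
          using geometric_rate_bigo[where d = "\<lambda>n. d n \<omega>" and a = ?a] obs_rate_pos[where y = y, OF hyps] by blast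
      qed
    qed
  qed
  have rate: "AE \<omega> in M. \<forall>\<delta>. 0 < \<delta> \<and> \<delta> < r \<longrightarrow> (\<lambda>n. d n \<omega>) \<in> O(\<lambda>n. \<delta> powr (- real n))"
    using main
  proof eventually_elim
    case (elim \<omega>)
    show ?case
    proof (intro allI impI)
      fix \<delta> assume \<delta>: "0 < \<delta> \<and> \<delta> < r"
      obtain \<rho> where "\<rho> \<in> \<rat>" "\<delta> < \<rho>" "\<rho> < r"
        using Rats_dense_in_real \<delta> by blast
      then show "(\<lambda>n. d n \<omega>) \<in> O(\<lambda>n. \<delta> powr (- real n))"
        using elim \<delta> by auto
    qed
  qed
  moreover have "AE \<omega> in M. (\<lambda>n. d n \<omega>) \<longlonglongrightarrow> 0"
    using rate
  proof eventually_elim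
    case (elim \<omega>)
    \<comment> \<open>As \<open>r > 1\<close>, an admissible rate above \<open>1\<close> exists, and
      its bound tends to \<open>0\<close>.\<close>
    obtain \<delta> where \<delta>: "1 < \<delta>" "\<delta> < r" using dense r by blast
    have "(\<lambda>n. (1 / \<delta>) ^ n) \<longlonglongrightarrow> 0"
      using \<delta> by (intro LIMSEQ_power_zero) auto
    moreover have "(1 / \<delta>) ^ n = \<delta> powr (- real n)" for n
      using \<delta> by (simp add: powr_minus powr_realpow power_one_over inverse_eq_divide)
    ultimately have small: "(\<lambda>n. \<delta> powr (- real n)) \<in> o(\<lambda>_. 1)"
      by (intro smalloI_tendsto) auto
    have "0 < \<delta> \<and> \<delta> < r" using \<delta> by simp
    then have "(\<lambda>n. d n \<omega>) \<in> O(\<lambda>n. \<delta> powr (- real n))"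
      using elim by blast
    then have "(\<lambda>n. d n \<omega>) \<in> o(\<lambda>_. 1)"
      using small by (rule landau_o.big_small_trans)
    from smalloD_tendsto[OF this] show ?case
      by simp
  qed
  ultimately show ?thesis
    using r by blast
qed

end
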